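(* Let $s\in(0,2)$. There exists $C>0$ such that for all $\mathbf i\in\Sigma$ and $n\in\mathbb N$, $$C^{-1}\le\frac{\nu([\mathbf i|_n])}{\phi^s(\mathbf i|_n)\exp(-nP_A(f_{1,s}))}\le C.$$ In particular, $\nu=m$, where $m=m^s$ is the unique K\"aenm\"aki measure for $\phi^s$, and $P(s)=P_A(f_{1,s})=P_A(f_{2,s})$.
   Context: **Matrices.** Let $\mathcal I=\{1,\dots,d\}$, let $1<l\le d$, and let $a_i,b_i\in(0,1)$ for $i\in\mathcal I$. Put $A_i=\begin{bmatrix} a_i & 0 \\ 0 & b_i \end{bmatrix}$ for $i<l$ and $A_i=\begin{bmatrix} 0 & a_i \\ b_i & 0 \end{bmatrix}$ for $i\ge l$. Assume $a_i\ne b_i$ for some $1\le i\le l-1$. **Symbolic notation.** $\mathcal I^*=\bigcup_{k\ge1}\mathcal I^k$; $\Sigma=\mathcal I^{\mathbb N}$ with the product topology and left shift $\sigma$. For $\mathbf i=(i_1,i_2,\dots)\in\Sigma$, $\mathbf i|_k=(i_1,\dots,i_k)$. For a finite word $\mathbf i=(i_1,\dots,i_k)$, $|\mathbf i|=k$, $[\mathbf i]$ is the cylinder of sequences beginning with $\mathbf i$, and $\alpha_1(\mathbf i)\ge\alpha_2(\mathbf i)>0$ are the singular values of $A_{i_1}\cdots A_{i_k}$. **K\"aenm\"aki measure.** For $s\in(0,2]$ let $\phi^s(\mathbf i)=\alpha_1(\mathbf i)^s$ if $s<1$ and $\phi^s(\mathbf i)=\alpha_1(\mathbf i)\alpha_2(\mathbf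 i)^{s-1}$ if $s\in[1,2]$, and $P(s)=\lim_{n\to\infty}\frac1n\log\sum_{\mathbf i\in\mathcal I^n}\phi^s(\mathbf i)$. For $s\in(0,2)$, the K\"aenm\"aki measure $m=m^s$ is the (unique) $\sigma$-invariant ergodic Borel probability measure on $\Sigma$ for which there is $C_0\ge1$ with $C_0^{-1}e^{-P(s)|\mathbf i|}\phi^s(\mathbf i)\le m([\mathbf i])\le C_0e^{-P(s)|\mathbf i|}\phi^s(\mathbf i)$ for all $\mathbf i\in\mathcal I^*$ (its existence and uniqueness are known). **Associated subshift.** $\Sigma_A\subset\{1,\dots,2d\}^{\mathbb N}$ is the (one-sided) subshift of finite type with transition matrix $A(i,j)=1$ if $i\in\{1,\dots,l-1\}\cup\{d+l,\dots,2d\}$ and $j\le d$; $A(i,j)=1$ if $i\in\{l,\dots,d+l-1\}$ and $j>d$; $A(i,j)=0$ otherwise. The injection $\tau:\Sigma\to\Sigma_A$ is given by $\tau(\mathbf i)=(\tau_1(\mathbf i),\tau_2(\mathbf i),\dots)$ with $\tau_m(\mathbf i)=i_m$ if $\#\{1\le j\le m-1:i_j\ge l\}$ is even and $\tau_m(\mathbf i)=i_m+d$ if it is odd. Define $f_{1,s},f_{2,s}:\Sigma_A\to\mathbb R$, depending only on the first symbol $i_1$: for $s\in(0,1)$: $f_{1,s}=s\log a_{i_1}$, $f_{2,s}=s\log b_{i_1}$ if $i_1\le d$; $f_{1,s}=s\log b_{i_1-d}$, $f_{2,s}=s\log a_{i_1-d}$ if $i_1\ge d+1$; for $s\in[1,2]$: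 $f_{1,s}=\log a_{i_1}+(s-1)\log b_{i_1}$, $f_{2,s}=\log b_{i_1}+(s-1)\log a_{i_1}$ if $i_1\le d$; $f_{1,s}=\log b_{i_1-d}+(s-1)\log a_{i_1-d}$, $f_{2,s}=\log a_{i_1-d}+(s-1)\log b_{i_1-d}$ if $i_1\ge d+1$. $P_A(f)$ denotes the topological pressure of $f$ on $\Sigma_A$. For $t=1,2$, $m_t$ is the unique shift-invariant Gibbs probability measure on the (mixing) subshift $\Sigma_A$ for $f_{t,s}$, i.e. $m_t([\mathbf i|_n])$ is comparable, up to a multiplicative constant independent of $\mathbf i\in\Sigma_A$ and $n$, to $\exp(S_nf_{t,s}(\mathbf i)-nP_A(f_{t,s}))$, where $S_nf=\sum_{k=0}^{n-1}f\circ\sigma^k$. The Borel measure $\nu$ on $\Sigma$ is defined by $\nu(E)=m_1(\tau(E))+m_2(\tau(E))$. *)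

theory Defs
  imports "HOL-Probability.Probability"
begin

text \<open>
  Infinite words are functions \<open>nat \<Rightarrow> nat\<close> indexed from 0, so the first symbol
  of \<open>x\<close> is \<open>x 0\<close>; finite words are lists. The alphabet of \<open>d\<close> symbols is \<open>{1..d}\<close>.
  The type \<open>nat \<Rightarrow> nat\<close> carries the product of the discrete topologies, and a
  subset \<open>X\<close> of it is given the Borel sets \<open>restrict_space borel X\<close>.
\<close>

definition full_shift :: "nat \<Rightarrow> (nat \<Rightarrow> nat) set" where
  "full_shift d = {x. \<forall>k. x k \<in> {1..d}}"

definition shift :: "(nat \<Rightarrow> nat) \<Rightarrow> nat \<Rightarrow> nat" where
  "shift x = (\<lambda>k. x (Suc k))"

definition prefix_word :: "(nat \<Rightarrow> nat) \<Rightarrow> nat \<Rightarrow> nat list" where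
  "prefix_word x n = map x [0..<n]"

definition cylinder :: "(nat \<Rightarrow> nat) set \<Rightarrow> nat list \<Rightarrow> (nat \<Rightarrow> nat) set" where
  "cylinder X w = {x \<in> X. prefix_word x (length w) = w}"

definition words :: "nat \<Rightarrow> nat \<Rightarrow> nat list set" where
  "words d n = {w. length w = n \<and> set w \<subseteq> {1..d}}"

definition borel_prob_on :: "(nat \<Rightarrow> nat) set \<Rightarrow> (nat \<Rightarrow> nat) measure \<Rightarrow> bool" where
  "borel_prob_on X m \<longleftrightarrow> sets m = sets (restrict_space borel X) \<and> prob_space m"

definition shift_invariant :: "(nat \<Rightarrow> nat) measure \<Rightarrow> bool" where
  "shift_invariant m \<longleftrightarrow>
     (\<forall>E\<in>sets m. emeasure m (shift -` E \<inter> space m) = emeasure m E)"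

definition shift_ergodic :: "(nat \<Rightarrow> nat) measure \<Rightarrow> bool" where
  "shift_ergodic m \<longleftrightarrow>
     (\<forall>E\<in>sets m. shift -` E \<inter> space m = E \<longrightarrow> measure m E = 0 \<or> measure m E = 1)"

definition A_mat :: "nat \<Rightarrow> (nat \<Rightarrow> real) \<Rightarrow> (nat \<Rightarrow> real) \<Rightarrow> nat \<Rightarrow> real^2^2" where
  "A_mat l a b i =
     (if i < l then vector [vector [a i, 0], vector [0, b i]]
      else vector [vector [0, a i], vector [b i, 0]])"

definition A_prod :: "nat \<Rightarrow> (nat \<Rightarrow> real) \<Rightarrow> (nat \<Rightarrow> real) \<Rightarrow> nat list \<Rightarrow> real^2^2" where
  "A_prod l a b w = foldr (\<lambda>i M. A_mat l a b i ** M) w (mat 1)"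

text \<open>
  The singular values of \<open>M\<close> are the square roots of the eigenvalues of \<open>M\<^sup>T M\<close>.
  For a \<open>2 \<times> 2\<close> matrix the larger and the smaller one (counted with multiplicity)
  are the maximum and the minimum of the set of singular values.
\<close>

definition singular_values :: "real^2^2 \<Rightarrow> real set" where
  "singular_values M =
     {sqrt r | r. \<exists>v. v \<noteq> 0 \<and> (transpose M ** M) *v v = r *\<^sub>R v}"

definition alpha1 :: "nat \<Rightarrow> (nat \<Rightarrow> real) \<Rightarrow> (nat \<Rightarrow> real) \<Rightarrow> nat list \<Rightarrow> real" where
  "alpha1 l a b w = Max (singular_values (A_prod l a b w))"

definition alpha2 :: "nat \<Rightarrow> (nat \<Rightarrow> real) \<Rightarrow> (nat \<Rightarrow> real) \<Rightarrow> nat list \<Rightarrow> real" where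
  "alpha2 l a b w = Min (singular_values (A_prod l a b w))"

definition phi :: "nat \<Rightarrow> (nat \<Rightarrow> real) \<Rightarrow> (nat \<Rightarrow> real) \<Rightarrow> real \<Rightarrow> nat list \<Rightarrow> real" where
  "phi l a b s w =
     (if s < 1 then alpha1 l a b w powr s
      else alpha1 l a b w * alpha2 l a b w powr (s - 1))"

definition P_mat :: "nat \<Rightarrow> nat \<Rightarrow> (nat \<Rightarrow> real) \<Rightarrow> (nat \<Rightarrow> real) \<Rightarrow> real \<Rightarrow> real" where
  "P_mat d l a b s = lim (\<lambda>n. ln (\<Sum>w\<in>words d n. phi l a b s w) / real n)"

definition kaenmaki_measure ::
  "nat \<Rightarrow> nat \<Rightarrow> (nat \<Rightarrow> real) \<Rightarrow> (nat \<Rightarrow> real) \<Rightarrow> real \<Rightarrow> (nat \<Rightarrow> nat) measure \<Rightarrow> bool" where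
  "kaenmaki_measure d l a b s m \<longleftrightarrow>
     borel_prob_on (full_shift d) m \<and> shift_invariant m \<and> shift_ergodic m \<and>
     (\<exists>C\<ge>1. \<forall>n\<ge>1. \<forall>w\<in>words d n.
        inverse C * exp (- P_mat d l a b s * real n) * phi l a b s w
          \<le> measure m (cylinder (full_shift d) w) \<and>
        measure m (cylinder (full_shift d) w)
          \<le> C * exp (- P_mat d l a b s * real n) * phi l a b s w)"

definition trans_mat :: "nat \<Rightarrow> nat \<Rightarrow> nat \<Rightarrow> nat \<Rightarrow> nat" where
  "trans_mat d l i j =
     (if i \<in> {1..l-1} \<union> {d+l..2*d} \<and> j \<le> d then 1
      else if i \<in> {l..d+l-1} \<and> j > d then 1
      else 0)"

definition Sigma_A :: "nat \<Rightarrow> nat \<Rightarrow> (nat \<Rightarrow> nat) set" where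
  "Sigma_A d l =
     {x \<in> full_shift (2*d). \<forall>k. trans_mat d l (x k) (x (Suc k)) = 1}"

definition tau :: "nat \<Rightarrow> nat \<Rightarrow> (nat \<Rightarrow> nat) \<Rightarrow> nat \<Rightarrow> nat" where
  "tau d l x = (\<lambda>m. if even (card {j. j < m \<and> l \<le> x j}) then x m else x m + d)"

definition f1 ::
  "nat \<Rightarrow> (nat \<Rightarrow> real) \<Rightarrow> (nat \<Rightarrow> real) \<Rightarrow> real \<Rightarrow> (nat \<Rightarrow> nat) \<Rightarrow> real" where
  "f1 d a b s x =
     (if s < 1 then
        (if x 0 \<le> d then s * ln (a (x 0)) else s * ln (b (x 0 - d)))
      else
        (if x 0 \<le> d then ln (a (x 0)) + (s - 1) * ln (b (x 0))
         else ln (b (x 0 - d)) + (s - 1) * ln (a (x 0 - d))))"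

definition f2 ::
  "nat \<Rightarrow> (nat \<Rightarrow> real) \<Rightarrow> (nat \<Rightarrow> real) \<Rightarrow> real \<Rightarrow> (nat \<Rightarrow> nat) \<Rightarrow> real" where
  "f2 d a b s x =
     (if s < 1 then
        (if x 0 \<le> d then s * ln (b (x 0)) else s * ln (a (x 0 - d)))
      else
        (if x 0 \<le> d then ln (b (x 0)) + (s - 1) * ln (a (x 0))
         else ln (a (x 0 - d)) + (s - 1) * ln (b (x 0 - d))))"

definition birkhoff_sum :: "((nat \<Rightarrow> nat) \<Rightarrow> real) \<Rightarrow> nat \<Rightarrow> (nat \<Rightarrow> nat) \<Rightarrow> real" where
  "birkhoff_sum f n x = (\<Sum>k<n. f ((shift ^^ k) x))"

text \<open>
  Topological pressure of \<open>f\<close> on a subshift \<open>X\<close>: the exponential growth rate of the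
  sum, over the words of length \<open>n\<close> that occur as prefixes in \<open>X\<close>, of the supremum
  of \<open>exp (S\<^sub>n f)\<close> on the corresponding cylinder.
\<close>

definition top_pressure :: "(nat \<Rightarrow> nat) set \<Rightarrow> ((nat \<Rightarrow> nat) \<Rightarrow> real) \<Rightarrow> real" where
  "top_pressure X f =
     lim (\<lambda>n. ln (\<Sum>w\<in>(\<lambda>x. prefix_word x n) ` X.
                    SUP x\<in>cylinder X w. exp (birkhoff_sum f n x)) / real n)"

definition gibbs_measure ::
  "(nat \<Rightarrow> nat) set \<Rightarrow> ((nat \<Rightarrow> nat) \<Rightarrow> real) \<Rightarrow> (nat \<Rightarrow> nat) measure \<Rightarrow> bool" where
  "gibbs_measure X f m \<longleftrightarrow>
     borel_prob_on X m \<and> shift_invariant m \<and>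
     (\<exists>C\<ge>1. \<forall>x\<in>X. \<forall>n\<ge>1.
        inverse C * exp (birkhoff_sum f n x - real n * top_pressure X f)
          \<le> measure m (cylinder X (prefix_word x n)) \<and>
        measure m (cylinder X (prefix_word x n))
          \<le> C * exp (birkhoff_sum f n x - real n * top_pressure X f))"

definition nu ::
  "nat \<Rightarrow> nat \<Rightarrow> (nat \<Rightarrow> nat) measure \<Rightarrow> (nat \<Rightarrow> nat) measure \<Rightarrow> (nat \<Rightarrow> nat) measure" where
  "nu d l m1 m2 =
     measure_of (full_shift d) (sets (restrict_space borel (full_shift d)))
       (\<lambda>E. emeasure m1 (tau d l ` E) + emeasure m2 (tau d l ` E))"

end

theory Submission
  imports Defs
begin

text \<open>
  The product \<open>A\<^sub>w\<close> is a generalised permutation matrix: each of its rows has exactly one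
  non-zero entry, and following a row through the product amounts to following a two-state
  automaton that switches state at every antidiagonal factor. The subshift \<open>\<Sigma>\<^sub>A\<close> records this
  state, which is why \<open>exp (S\<^sub>n f\<^sub>1 (\<tau> x))\<close> and \<open>exp (S\<^sub>n f\<^sub>2 (\<tau> x))\<close> are the weights of the two
  rows of \<open>A\<^sub>w\<close> for \<open>w = x|\<^sub>n\<close> (\<open>exp_birkhoff_sum_tau\<close>). The two row entries are the singular
  values, so \<open>\<phi>\<^sup>s(w)\<close> is exactly the larger of the two weights (\<open>phi_eq_max_row_weight\<close>), and the
  sum of the two Gibbs estimates is an estimate by \<open>\<phi>\<^sup>s\<close> (\<open>nu_gibbs_bounds\<close>).

  What makes \<open>\<nu>\<close> an invariant probability measure is a symmetry. Exchanging the two copies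
  \<open>{1..d}\<close> and \<open>{d+1..2d}\<close> of the alphabet is an involution of \<open>\<Sigma>\<^sub>A\<close> that commutes with the shift
  and turns \<open>f\<^sub>1\<close> into \<open>f\<^sub>2\<close>. Hence the pressures of \<open>f\<^sub>1\<close> and \<open>f\<^sub>2\<close> agree and, by uniqueness of
  Gibbs measures, \<open>m\<^sub>2\<close> is the image of \<open>m\<^sub>1\<close> under the exchange. The sets \<open>\<tau>(E)\<close> and its exchanged
  copy together form the preimage of \<open>E\<close> under the factor map \<open>\<pi>\<close> from \<open>\<Sigma>\<^sub>A\<close> to \<open>\<Sigma>\<close> that forgets
  the copy, so \<open>\<nu> = \<pi>\<^sub>* m\<^sub>1\<close> (\<open>nu_eq_distr\<close>). Total mass, invariance and ergodicity of \<open>\<nu>\<close> are then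
  inherited from \<open>m\<^sub>1\<close>. Summing the estimate over all words of length \<open>n\<close> identifies the pressure
  \<open>P(s)\<close>.

  Both uniqueness statements, for Gibbs measures on \<open>\<Sigma>\<^sub>A\<close> and for the Kaenmaki measure, come from
  one principle (\<open>almost_ergodic_dominated_eq\<close>): an invariant probability measure whose cylinder
  masses are at most a constant times those of an ergodic one is equal to it. Ergodicity of Gibbs
  measures comes from a quasi-Bernoulli inequality, which holds because any two admissible words
  can be joined through a single intermediate symbol.
\<close>

section \<open>Cylinders and comparison of measures\<close>

lemma prefix_word_eq_iff: "prefix_word x n = prefix_word y n \<longleftrightarrow> (\<forall>k<n. x k = y k)"
  by (auto simp: prefix_word_def)

lemma length_prefix_word [simp]: "length (prefix_word x n) = n"
  by (simp add: prefix_word_def)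

lemma prefix_word_eq_list_iff: "prefix_word x (length w) = w \<longleftrightarrow> (\<forall>k<length w. x k = w ! k)"
  using list_eq_iff_nth_eq[of "prefix_word x (length w)" w] by (simp add: prefix_word_def)

lemma cylinder_prefix_word: "cylinder X (prefix_word x n) = {y \<in> X. \<forall>k<n. y k = x k}"
  by (simp add: cylinder_def prefix_word_eq_iff)

lemma cylinder_eq_Int: "cylinder X w = X \<inter> (\<Inter>k\<in>{..<length w}. {x. x k = w ! k})"
  unfolding cylinder_def prefix_word_eq_list_iff by blast

lemma open_coordinate_eq: "open {x::nat \<Rightarrow> nat. x k = j}"
proof -
  have "open (UNIV \<inter> (\<lambda>x::nat \<Rightarrow> nat. x k) -` {j})"
    by (rule continuous_open_preimage[OF continuous_on_product_coordinates]) (auto simp: discrete_topology_class.open_discrete)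
  moreover have "UNIV \<inter> (\<lambda>x::nat \<Rightarrow> nat. x k) -` {j} = {x. x k = j}" by auto
  ultimately show ?thesis by simp
qed

lemma cylinder_measurable: "cylinder X w \<in> sets (restrict_space borel X)"
proof -
  have "open (\<Inter>k\<in>{..<length w}. {x::nat \<Rightarrow> nat. x k = w ! k})"
    by (rule open_INT) (simp_all add: open_coordinate_eq)
  then have "(\<Inter>k\<in>{..<length w}. {x::nat \<Rightarrow> nat. x k = w ! k}) \<in> sets borel"
    by (rule borel_open)
  from imageI[OF this, of "(\<inter>) X"] show ?thesis
    by (simp only: cylinder_eq_Int sets_restrict_space)
qed

lemma open_contains_prefix_class:
  fixes U :: "(nat \<Rightarrow> nat) set"
  assumes "open U" "x \<in> U"
  shows "\<exists>n. {y. prefix_word y n = prefix_word x n} \<subseteq> U"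
proof -
  have "openin (product_topology (\<lambda>i. euclidean) UNIV) U"
    using assms(1) by (simp only: open_fun_def)
  from product_topology_open_contains_basis[OF this assms(2)]
  obtain Y where Y: "x \<in> (\<Pi>\<^sub>E i\<in>UNIV. Y i)" "finite {i. Y i \<noteq> UNIV}" "(\<Pi>\<^sub>E i\<in>UNIV. Y i) \<subseteq> U"
    by auto
  from Y(2) obtain n where n: "{i. Y i \<noteq> UNIV} \<subseteq> {..<n}"
    using finite_nat_iff_bounded by auto
  have "{y. prefix_word y n = prefix_word x n} \<subseteq> U"
  proof
    fix y assume "y \<in> {y. prefix_word y n = prefix_word x n}"
    then have y: "\<forall>k<n. y k = x k" by (simp add: prefix_word_eq_iff)
    have "y i \<in> Y i" for i
    proof (cases "i < n")
      case True then show ?thesis using y Y(1) by (auto simp: PiE_iff)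
    next
      case False
      then have "Y i = UNIV" using n by auto
      then show ?thesis by simp
    qed
    then have "y \<in> (\<Pi>\<^sub>E i\<in>UNIV. Y i)" by auto
    then show "y \<in> U" using Y(3) by blast
  qed
  then show ?thesis by blast
qed

text \<open>
  Outer regularity holds on Polish spaces. A sequence of naturals is regarded here as a sequence
  of reals, so that the metric structure of \<open>nat \<Rightarrow> real\<close> becomes available; rounding down is a
  Borel left inverse of this embedding and carries Borel sets across.
\<close>

lemma outer_regular_nat_sequences:
  fixes N :: "(nat \<Rightarrow> nat) measure"
  assumes sb: "sets N = sets borel" and fin: "emeasure N (space N) \<noteq> \<infinity>"
    and B: "B \<in> sets borel"
  shows "emeasure N B = (INF U \<in> {U. B \<subseteq> U \<and> open U}. emeasure N U)"
proof (rule antisym)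
  define e :: "(nat \<Rightarrow> nat) \<Rightarrow> nat \<Rightarrow> real" where "e x = (\<lambda>k. real (x k))" for x
  define r :: "(nat \<Rightarrow> real) \<Rightarrow> nat \<Rightarrow> nat" where "r y = (\<lambda>k. nat \<lfloor>y k\<rfloor>)" for y
  have re: "r (e x) = x" for x by (simp add: r_def e_def)
  have cont: "continuous_on UNIV e"
    unfolding e_def
    by (intro continuous_on_coordinatewise_then_product continuous_on_compose2[OF _ continuous_on_product_coordinates, of UNIV real]) auto
  then have e_borel: "e \<in> borel_measurable borel"
    by (rule borel_measurable_continuous_onI)
  have e: "e \<in> measurable N borel"
    using e_borel sb by (simp cong: measurable_cong_sets)
  have r: "r \<in> borel_measurable borel"
    unfolding r_def by (rule measurable_coordinatewise_then_product) measurable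
  have spN: "space N = UNIV" using sets_eq_imp_space_eq[OF sb] by simp
  have em: "emeasure (distr N borel e) C = emeasure N (e -` C)" if "C \<in> sets borel" for C
    using emeasure_distr[OF e that] by (simp add: spN)
  have rB: "r -` B \<in> sets borel"
    using measurable_sets[OF r B] by simp
  have eq: "e -` (r -` B) = B" by (auto simp: re)
  have "emeasure N B = emeasure (distr N borel e) (r -` B)"
    using em[OF rB] eq by simp
  also have "\<dots> = (INF U \<in> {U. r -` B \<subseteq> U \<and> open U}. emeasure (distr N borel e) U)"
    by (rule outer_regular) (use fin rB em[of UNIV] in \<open>auto simp: spN\<close>)
  also have "\<dots> \<ge> (INF U \<in> {U. B \<subseteq> U \<and> open U}. emeasure N U)"
  proof (rule INF_greatest)
    fix U :: "(nat \<Rightarrow> real) set" assume U: "U \<in> {U. r -` B \<subseteq> U \<and> open U}"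
    then have "open (e -` U)"
      using continuous_open_preimage[OF cont] by simp
    moreover have "B \<subseteq> e -` U"
    proof
      fix x assume "x \<in> B"
      then have "e x \<in> r -` B" by (simp add: re)
      then show "x \<in> e -` U" using U by blast
    qed
    ultimately have "(INF U \<in> {U. B \<subseteq> U \<and> open U}. emeasure N U) \<le> emeasure N (e -` U)"
      by (intro INF_lower) auto
    then show "(INF U \<in> {U. B \<subseteq> U \<and> open U}. emeasure N U) \<le> emeasure (distr N borel e) U"
      using U em by auto
  qed
  finally show "(INF U \<in> {U. B \<subseteq> U \<and> open U}. emeasure N U) \<le> emeasure N B" .
next
  show "emeasure N B \<le> (INF U \<in> {U. B \<subseteq> U \<and> open U}. emeasure N U)"
    by (intro INF_greatest emeasure_mono) (auto simp: sb)
qed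

lemma finite_words: "finite (words d n)"
  unfolding words_def by (rule finite_subset[OF _ finite_lists_length_eq[of "{1..d}" n]]) auto

lemma prefix_word_in_words: "x \<in> full_shift d \<Longrightarrow> prefix_word x n \<in> words d n"
  unfolding full_shift_def words_def prefix_word_def by auto

text \<open>
  An open set is the increasing union, over \<open>n\<close>, of the cylinders of length \<open>n\<close> contained in it.
  The alphabet being finite, each stage is a finite disjoint union of cylinders.
\<close>

lemma cylinder_domination_open:
  fixes N1 N2 :: "(nat \<Rightarrow> nat) measure"
  assumes X: "X \<subseteq> full_shift D"
    and N1: "finite_measure N1" "sets N1 = sets (restrict_space borel X)"
    and N2: "finite_measure N2" "sets N2 = sets (restrict_space borel X)"
    and dom: "\<And>w. measure N1 (cylinder X w) \<le> c * measure N2 (cylinder X w)"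
    and U: "open U"
  shows "measure N1 (X \<inter> U) \<le> c * measure N2 (X \<inter> U)"
proof -
  interpret N1: finite_measure N1 by fact
  interpret N2: finite_measure N2 by fact
  define W where "W n = {w \<in> words D n. {y. prefix_word y n = w} \<subseteq> U}" for n
  define V where "V n = (\<Union>w\<in>W n. cylinder X w)" for n
  have finW: "finite (W n)" for n using finite_words by (auto simp: W_def)
  have len: "length w = n" if "w \<in> W n" for w n using that by (auto simp: W_def words_def)
  have disj: "disjoint_family_on (cylinder X) (W n)" for n
    unfolding disjoint_family_on_def
  proof (intro ballI impI)
    fix v w assume "v \<in> W n" "w \<in> W n" "v \<noteq> w"
    then show "cylinder X v \<inter> cylinder X w = {}"
      using len[of v] len[of w] by (auto simp: cylinder_def)
  qed
  have cyl1: "cylinder X w \<in> sets N1" and cyl2: "cylinder X w \<in> sets N2" for w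
    using cylinder_measurable N1 N2 by auto
  have V1: "V n \<in> sets N1" and V2: "V n \<in> sets N2" for n
    unfolding V_def using cyl1 cyl2 finW by auto
  have V: "measure N1 (V n) \<le> c * measure N2 (V n)" for n
  proof -
    have "measure N1 (V n) = (\<Sum>w\<in>W n. measure N1 (cylinder X w))"
      unfolding V_def using cyl1 finW disj by (intro N1.finite_measure_finite_Union) auto
    also have "\<dots> \<le> (\<Sum>w\<in>W n. c * measure N2 (cylinder X w))"
      by (intro sum_mono dom)
    also have "\<dots> = c * (\<Sum>w\<in>W n. measure N2 (cylinder X w))"
      by (simp add: sum_distrib_left)
    also have "(\<Sum>w\<in>W n. measure N2 (cylinder X w)) = measure N2 (V n)"
      unfolding V_def using cyl2 finW disj by (intro N2.finite_measure_finite_Union[symmetric]) auto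
    finally show ?thesis .
  qed
  have V_eq: "V n = {x \<in> X. {y. prefix_word y n = prefix_word x n} \<subseteq> U}" for n
  proof (intro set_eqI iffI)
    fix x assume "x \<in> V n"
    then obtain w where "w \<in> W n" "x \<in> cylinder X w" by (auto simp: V_def)
    then show "x \<in> {x \<in> X. {y. prefix_word y n = prefix_word x n} \<subseteq> U}"
      using len[of w] by (auto simp: cylinder_def W_def)
  next
    fix x assume x: "x \<in> {x \<in> X. {y. prefix_word y n = prefix_word x n} \<subseteq> U}"
    then have "prefix_word x n \<in> W n"
      using X prefix_word_in_words[of x D n] by (auto simp: W_def)
    moreover have "x \<in> cylinder X (prefix_word x n)"
      using x by (simp add: cylinder_def)
    ultimately show "x \<in> V n" by (auto simp: V_def)
  qed
  have "incseq V"
    unfolding incseq_def V_eq by (auto simp: prefix_word_eq_iff)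
  moreover have "(\<Union>n. V n) = X \<inter> U"
    unfolding V_eq using open_contains_prefix_class[OF U] by auto
  ultimately have "(\<lambda>n. measure N1 (V n)) \<longlonglongrightarrow> measure N1 (X \<inter> U)"
     "(\<lambda>n. measure N2 (V n)) \<longlonglongrightarrow> measure N2 (X \<inter> U)"
    using N1.finite_Lim_measure_incseq[of V] N2.finite_Lim_measure_incseq[of V] V1 V2 by auto
  then show ?thesis
    using V by (intro LIMSEQ_le[OF _ tendsto_mult_left[of _ _ _ c]]) auto
qed

text \<open>
  Outer regularity of the dominating measure passes the inequality from open sets to all Borel
  sets. A \<open>\<pi>\<close>-\<open>\<lambda>\<close> argument would not do: the sets for which an inequality between measures holds
  are not closed under complement.
\<close>

lemma cylinder_domination:
  fixes N1 N2 :: "(nat \<Rightarrow> nat) measure"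
  assumes X: "X \<subseteq> full_shift D"
    and N1: "finite_measure N1" "sets N1 = sets (restrict_space borel X)"
    and N2: "finite_measure N2" "sets N2 = sets (restrict_space borel X)"
    and c: "0 \<le> c"
    and dom: "\<And>w. measure N1 (cylinder X w) \<le> c * measure N2 (cylinder X w)"
    and E: "E \<in> sets N1"
  shows "measure N1 E \<le> c * measure N2 E"
proof -
  interpret N1: finite_measure N1 by fact
  interpret N2: finite_measure N2 by fact
  have sp: "space N2 = X"
    using sets_eq_imp_space_eq[OF N2(2)] by (simp add: space_restrict_space)
  obtain B where B: "B \<in> sets borel" "E = X \<inter> B"
    using E N1(2) by (auto simp: sets_restrict_space)
  have id2: "id \<in> measurable N2 borel"
    using measurable_cong_sets[OF N2(2) refl] measurable_restrict_space1[of id borel borel X] by auto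
  have ext: "emeasure (distr N2 borel id) C = emeasure N2 (X \<inter> C)" if "C \<in> sets borel" for C
    using emeasure_distr[OF id2 that] by (simp add: sp Int_commute)
  have "measure N1 E \<le> c * (measure N2 E + \<epsilon>)" if \<epsilon>: "\<epsilon> > 0" for \<epsilon>
  proof -
    have "emeasure (distr N2 borel id) (space (distr N2 borel id)) \<noteq> \<infinity>"
      using ext[of UNIV] N2.emeasure_eq_measure by simp
    then have "(INF U \<in> {U. B \<subseteq> U \<and> open U}. emeasure (distr N2 borel id) U) = emeasure N2 E"
      using outer_regular_nat_sequences[of "distr N2 borel id" B] B ext by simp
    also have "emeasure N2 E < ennreal (measure N2 E + \<epsilon>)"
      using \<epsilon> by (simp add: N2.emeasure_eq_measure ennreal_less_iff)
    finally obtain U where U: "B \<subseteq> U" "open U" "emeasure (distr N2 borel id) U < ennreal (measure N2 E + \<epsilon>)"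
      by (auto simp: INF_less_iff)
    then have U': "measure N2 (X \<inter> U) < measure N2 E + \<epsilon>"
      using ext[of U] by (simp add: N2.emeasure_eq_measure ennreal_less_iff del: ennreal_plus)
    have "X \<inter> U \<in> sets N1" using U(2) N1(2) by (auto simp: sets_restrict_space)
    then have "measure N1 E \<le> measure N1 (X \<inter> U)"
      using B U(1) by (intro N1.finite_measure_mono) auto
    also have "\<dots> \<le> c * measure N2 (X \<inter> U)"
      by (rule cylinder_domination_open[OF X N1 N2 dom U(2)])
    also have "\<dots> \<le> c * (measure N2 E + \<epsilon>)"
      using U' c by (intro mult_left_mono) auto
    finally show ?thesis .
  qed
  then have "measure N1 E \<le> c * measure N2 E + \<delta>" if "\<delta> > 0" for \<delta>
  proof (cases "c = 0")
    case True
    then show ?thesis using \<open>\<And>\<epsilon>. \<epsilon> > 0 \<Longrightarrow> measure N1 E \<le> c * (measure N2 E + \<epsilon>)\<close>[of 1] that by simp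
  next
    case False
    then show ?thesis
      using \<open>\<And>\<epsilon>. \<epsilon> > 0 \<Longrightarrow> measure N1 E \<le> c * (measure N2 E + \<epsilon>)\<close>[of "\<delta> / c"] that c
      by (simp add: distrib_left)
  qed
  then show ?thesis by (rule field_le_epsilon)
qed

section \<open>Ergodicity and domination\<close>

text \<open>
  Ergodicity tested on sets that are backward invariant up to a null set. For invariant measures
  this is equivalent to the usual notion, but it applies directly to the superlevel sets of a
  density, which are only almost invariant.
\<close>

definition almost_ergodic :: "('a \<Rightarrow> 'a) \<Rightarrow> 'a measure \<Rightarrow> bool" where
  "almost_ergodic T M \<longleftrightarrow>
     (\<forall>E\<in>sets M. (AE x in M. T x \<in> E \<longrightarrow> x \<in> E) \<longrightarrow> measure M E = 0 \<or> measure M E = 1)"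

lemma density_greater_one_null:
  fixes M :: "'a measure" and h :: "'a \<Rightarrow> ennreal"
  assumes M: "finite_measure M" and h [measurable]: "h \<in> borel_measurable M"
    and A [measurable]: "A \<in> sets M" and big: "\<And>x. x \<in> A \<Longrightarrow> 1 < h x"
    and le: "emeasure (density M h) A \<le> emeasure M A"
  shows "AE x in M. x \<notin> A"
proof -
  interpret finite_measure M by fact
  have "(\<integral>\<^sup>+x. (h x - 1) * indicator A x \<partial>M) + emeasure M A
      = (\<integral>\<^sup>+x. (h x - 1) * indicator A x + indicator A x \<partial>M)"
    by (subst nn_integral_add) auto
  also have "\<dots> = (\<integral>\<^sup>+x. h x * indicator A x \<partial>M)"
  proof (rule nn_integral_cong)
    fix x
    show "(h x - 1) * indicator A x + indicator A x = h x * indicator A x"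
      using big[of x] by (auto simp: indicator_def diff_add_cancel_ennreal less_imp_le)
  qed
  also have "\<dots> = emeasure (density M h) A"
    by (simp add: emeasure_density)
  finally have "(\<integral>\<^sup>+x. (h x - 1) * indicator A x \<partial>M) + emeasure M A \<le> 0 + emeasure M A"
    using le by simp
  then have "(\<integral>\<^sup>+x. (h x - 1) * indicator A x \<partial>M) = 0"
    using emeasure_finite[of A] by (auto simp: ennreal_add_left_cancel_le add.commute[of _ "emeasure M A"])
  then have "AE x in M. (h x - 1) * indicator A x = 0"
    by (subst (asm) nn_integral_0_iff_AE) auto
  then show ?thesis
  proof (rule AE_mp, intro AE_I2 impI notI)
    fix x assume "(h x - 1) * indicator A x = 0" "x \<in> A"
    then have "h x - 1 = 0" by simp
    moreover have "1 < h x" using big \<open>x \<in> A\<close> by simp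
    ultimately show False by (auto simp: diff_eq_0_iff_ennreal)
  qed
qed

text \<open>
  Let \<open>h\<close> be the density of \<open>N\<close> with respect to \<open>M\<close>, and \<open>E = {h > 1}\<close>. By invariance, \<open>E\<close> loses
  under \<open>T\<^sup>-\<^sup>1\<close> as much mass as it gains, for either measure. The lost part lies in \<open>E\<close>, where \<open>N\<close>
  exceeds \<open>M\<close> strictly on sets of positive mass, and the gained part lies outside \<open>E\<close>, where \<open>N\<close> is
  at most \<open>M\<close>; so both are null and \<open>E\<close> is almost invariant. Ergodicity leaves two cases: if \<open>E\<close>
  had full measure, \<open>N\<close> would have total mass above 1, so \<open>E\<close> is null, \<open>N \<le> M\<close>, and equality
  follows because both masses are 1.
\<close>

lemma almost_ergodic_unique:
  fixes M N :: "'a measure"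
  assumes M: "prob_space M" and N: "prob_space N" and sets: "sets N = sets M"
    and T [measurable]: "T \<in> measurable M M"
    and invM: "\<And>E. E \<in> sets M \<Longrightarrow> emeasure M (T -` E \<inter> space M) = emeasure M E"
    and invN: "\<And>E. E \<in> sets M \<Longrightarrow> emeasure N (T -` E \<inter> space M) = emeasure N E"
    and ac: "absolutely_continuous M N"
    and erg: "almost_ergodic T M"
  shows "N = M"
proof -
  interpret M: prob_space M by fact
  interpret N: prob_space N by fact
  have space: "space N = space M" using sets_eq_imp_space_eq[OF sets] .
  obtain h where h [measurable]: "h \<in> borel_measurable M" and dens: "density M h = N"
    using M.Radon_Nikodym[OF ac sets] by auto
  define E where "E = {x \<in> space M. 1 < h x}"
  have E [measurable]: "E \<in> sets M" unfolding E_def by measurable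
  have TE [measurable]: "T -` E \<inter> space M \<in> sets M" using T E by (rule measurable_sets)
  have exch: "emeasure Q (E - (T -` E \<inter> space M)) = emeasure Q ((T -` E \<inter> space M) - E)"
    if Q: "finite_measure Q" "sets Q = sets M" "emeasure Q (T -` E \<inter> space M) = emeasure Q E" for Q
  proof -
    interpret Q: finite_measure Q by fact
    have "measure Q (E - (T -` E \<inter> space M)) = measure Q E - measure Q (E \<inter> (T -` E \<inter> space M))"
      using Q(2) E TE by (intro Q.finite_measure_Diff') auto
    moreover have "measure Q ((T -` E \<inter> space M) - E)
        = measure Q (T -` E \<inter> space M) - measure Q ((T -` E \<inter> space M) \<inter> E)"
      using Q(2) E TE by (intro Q.finite_measure_Diff') auto
    ultimately show ?thesis
      using Q(3) by (simp add: Q.emeasure_eq_measure Int_commute)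
  qed
  have small: "emeasure N B \<le> emeasure M B" if B [measurable]: "B \<in> sets M" and "B \<inter> E = {}" for B
  proof -
    have "emeasure N B = (\<integral>\<^sup>+x. h x * indicator B x \<partial>M)"
      by (simp add: dens[symmetric] emeasure_density)
    also have "\<dots> \<le> (\<integral>\<^sup>+x. indicator B x \<partial>M)"
    proof (rule nn_integral_mono)
      fix x assume "x \<in> space M"
      then show "h x * indicator B x \<le> indicator B x"
        using \<open>B \<inter> E = {}\<close> by (auto simp: indicator_def E_def)
    qed
    also have "\<dots> = emeasure M B" by simp
    finally show ?thesis .
  qed
  have null: "AE x in M. x \<notin> A" if "A \<in> sets M" "A \<subseteq> E" "emeasure N A \<le> emeasure M A" for A
    using that by (intro density_greater_one_null[OF M.finite_measure_axioms h]) (auto simp: dens E_def)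
  have "AE x in M. x \<notin> E - (T -` E \<inter> space M)"
  proof (rule null)
    have "emeasure N (E - (T -` E \<inter> space M)) = emeasure N ((T -` E \<inter> space M) - E)"
      using exch[of N] N.finite_measure_axioms sets invN[OF E] by simp
    also have "\<dots> \<le> emeasure M ((T -` E \<inter> space M) - E)"
      by (rule small) auto
    also have "\<dots> = emeasure M (E - (T -` E \<inter> space M))"
      using exch[of M] M.finite_measure_axioms invM[OF E] by simp
    finally show "emeasure N (E - (T -` E \<inter> space M)) \<le> emeasure M (E - (T -` E \<inter> space M))" .
  qed auto
  then have "AE x in M. T x \<in> space M - E \<longrightarrow> x \<in> space M - E"
    using AE_space by eventually_elim auto
  then consider "measure M (space M - E) = 0" | "measure M (space M - E) = 1"
    using erg E unfolding almost_ergodic_def by (metis sets.compl_sets)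
  then have E0: "measure M E = 0"
  proof cases
    case 1
    then have ME: "measure M E = 1" using M.prob_compl[OF E] by simp
    have "emeasure N E \<le> 1" by (rule N.emeasure_le_1)
    then have "AE x in M. x \<notin> E"
      using ME by (intro null) (auto simp: M.emeasure_eq_measure)
    then show ?thesis using E by (simp add: AE_iff_measurable[OF E] M.prob_eq_0)
  next
    case 2
    then show ?thesis using M.prob_compl[OF E] by simp
  qed
  have le: "emeasure N S \<le> emeasure M S" if S [measurable]: "S \<in> sets M" for S
  proof -
    have "AE x in M. x \<notin> E" using E0 M.prob_eq_0[OF E] by simp
    then have "AE x in M. h x * indicator S x \<le> indicator S x"
      using AE_space by eventually_elim (auto simp: E_def indicator_def)
    then have "(\<integral>\<^sup>+x. h x * indicator S x \<partial>M) \<le> (\<integral>\<^sup>+x. indicator S x \<partial>M)"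
      by (rule nn_integral_mono_AE)
    then show ?thesis by (simp add: dens[symmetric] emeasure_density)
  qed
  show "N = M"
  proof (rule measure_eqI[OF sets])
    fix S assume "S \<in> sets N"
    then have S: "S \<in> sets M" using sets by simp
    have "measure N S \<le> measure M S"
      using le[OF S] by (simp add: M.emeasure_eq_measure N.emeasure_eq_measure)
    moreover have "measure N (space M - S) \<le> measure M (space M - S)"
      using le[of "space M - S"] S by (simp add: M.emeasure_eq_measure N.emeasure_eq_measure)
    ultimately have "measure N S = measure M S"
      using M.prob_compl[OF S] N.prob_compl[of S] S sets space by simp
    then show "emeasure N S = emeasure M S"
      by (simp add: M.emeasure_eq_measure N.emeasure_eq_measure)
  qed
qed

lemma shift_measurable:
  assumes "\<And>x. x \<in> X \<Longrightarrow> shift x \<in> X"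
  shows "shift \<in> measurable (restrict_space borel X) (restrict_space borel X)"
proof (rule measurable_restrict_space3)
  show "shift \<in> borel_measurable borel"
    unfolding shift_def
    by (rule measurable_coordinatewise_then_product)
       (rule borel_measurable_continuous_onI, rule continuous_on_product_coordinates)
qed (use assms in auto)

lemma borel_prob_onD:
  assumes "borel_prob_on X M"
  shows "prob_space M" "sets M = sets (restrict_space borel X)" "space M = X" 
    "cylinder X w \<in> sets M"
  using assms sets_eq_imp_space_eq[of M "restrict_space borel X"] cylinder_measurable[of X w]
  by (auto simp: borel_prob_on_def space_restrict_space)

text \<open>
  Domination on cylinders spreads to Borel sets and gives absolute continuity.
\<close>

lemma almost_ergodic_dominated_eq:
  assumes X: "X \<subseteq> full_shift D" "\<And>x. x \<in> X \<Longrightarrow> shift x \<in> X"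
    and M: "borel_prob_on X M" "shift_invariant M" "almost_ergodic shift M"
    and N: "borel_prob_on X N" "shift_invariant N"
    and c: "0 \<le> c" and dom: "\<And>w. measure N (cylinder X w) \<le> c * measure M (cylinder X w)"
  shows "N = M"
proof -
  note Mp = borel_prob_onD[OF M(1)] and Np = borel_prob_onD[OF N(1)]
  interpret M: prob_space M by (rule Mp)
  interpret N: prob_space N by (rule Np)
  have sets: "sets N = sets M" using Mp(2) Np(2) by simp
  have "absolutely_continuous M N"
    unfolding absolutely_continuous_def
  proof
    fix E assume E: "E \<in> null_sets M"
    then have EM: "E \<in> sets M" "measure M E = 0" by (auto simp: null_sets_def measure_def)
    have "measure N E \<le> c * measure M E"
      by (rule cylinder_domination[OF X(1) N.finite_measure_axioms Np(2) M.finite_measure_axioms Mp(2) c dom])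
         (use EM sets in auto)
    then have "measure N E = 0" using EM(2) measure_nonneg[of N E] by simp
    then show "E \<in> null_sets N"
      using EM(1) sets by (simp add: null_sets_def N.emeasure_eq_measure)
  qed
  moreover have "shift \<in> measurable M M"
    using shift_measurable[OF X(2)] Mp(2) by (simp cong: measurable_cong_sets)
  ultimately show ?thesis
    using M(2) N(2) Mp(3) Np(3) sets
    by (intro almost_ergodic_unique[OF Mp(1) Np(1) sets _ _ _ _ M(3)])
       (auto simp: shift_invariant_def)
qed

lemma AE_funpow_invariant:
  assumes T: "T \<in> measurable M M" and distr: "distr M M T = M"
    and AE: "AE x in M. T x \<in> E \<longrightarrow> x \<in> E"
  shows "AE x in M. (T ^^ k) x \<in> E \<longrightarrow> x \<in> E"
proof (induction k)
  case (Suc k)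
  have "AE x in distr M M T. (T ^^ k) x \<in> E \<longrightarrow> x \<in> E"
    by (subst distr) (rule Suc)
  from AE_distrD[OF T this] AE show ?case
    by eventually_elim (auto simp: funpow_swap1)
qed simp

text \<open>
  Because \<open>k\<close> does not depend on \<open>v\<close>, the inequality compares two measures on the cylinders
  \<open>[v]\<close>, so \<open>[v]\<close> may be replaced by an arbitrary Borel set, in particular by an almost invariant
  set \<open>E\<close>. On such a set the shift disappears, which leaves
  \<open>M[u] M(E) \<le> K M([u] \<inter> E)\<close>. This is again a comparison of measures, now on the cylinders \<open>[u]\<close>;
  replacing \<open>[u]\<close> by the complement of \<open>E\<close> makes the right-hand side vanish.
\<close>

lemma almost_ergodic_if_quasi_Bernoulli:
  assumes X: "X \<subseteq> full_shift D" "\<And>x. x \<in> X \<Longrightarrow> shift x \<in> X"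
    and M: "borel_prob_on X M" "shift_invariant M"
    and K: "0 \<le> K"
    and mix: "\<And>u. \<exists>k. \<forall>v. measure M (cylinder X u) * measure M (cylinder X v)
                \<le> K * measure M (cylinder X u \<inter> (shift ^^ k) -` cylinder X v)"
  shows "almost_ergodic shift M"
  unfolding almost_ergodic_def
proof (intro ballI impI)
  fix E assume E: "E \<in> sets M" and AE: "AE x in M. shift x \<in> E \<longrightarrow> x \<in> E"
  note Mp = borel_prob_onD[OF M(1)]
  interpret M: prob_space M by (rule Mp)
  have shift: "shift \<in> measurable M M"
    using shift_measurable[OF X(2)] Mp(2) by (simp cong: measurable_cong_sets)
  have pow: "shift ^^ k \<in> measurable M M" for k
    by (induction k) (auto intro: measurable_compose[OF _ shift] simp: comp_def id_def)
  have dist: "distr M M shift = M"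
    using M(2) by (intro measure_eqI) (auto simp: emeasure_distr[OF shift] shift_invariant_def)
  have restr: "measure (density M (indicator S)) B = measure M (S \<inter> B)"
    if "S \<in> sets M" "B \<in> sets M" for S B
    using emeasure_restricted[OF that] by (simp add: measure_def)
  have fin: "finite_measure (density M (indicator S))" if "S \<in> sets M" for S
    using M.finite_measure_restricted[OF that] .
  show "measure M E = 0 \<or> measure M E = 1"
  proof (cases "measure M E = 0")
    case False
    then have pos: "0 < measure M E" by (simp add: zero_less_measure_iff)
    have cyl: "measure M (cylinder X u) \<le> (K / measure M E) * measure M (E \<inter> cylinder X u)" for u
    proof (cases "measure M (cylinder X u) = 0")
      case True
      then show ?thesis using K by simp
    next
      case nz: False
      then have pos': "0 < measure M (cylinder X u)" by (simp add: zero_less_measure_iff)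
      obtain k where k: "\<And>v. measure M (cylinder X u) * measure M (cylinder X v)
                \<le> K * measure M (cylinder X u \<inter> (shift ^^ k) -` cylinder X v)"
        using mix by blast
      \<comment> \<open>\<open>Q\<close> is the mass inside \<open>[u]\<close>, transported by \<open>shift ^^ k\<close>.\<close>
      define Q where "Q = distr (density M (indicator (cylinder X u))) M (shift ^^ k)"
      have pow': "shift ^^ k \<in> measurable (density M (indicator (cylinder X u))) M"
        using pow by simp
      have Q: "measure Q B = measure M (cylinder X u \<inter> (shift ^^ k) -` B)" if "B \<in> sets M" for B
      proof -
        have "measure Q B = measure M (cylinder X u \<inter> ((shift ^^ k) -` B \<inter> space M))"
          unfolding Q_def measure_distr[OF pow' that]
          using restr[OF Mp(4) measurable_sets[OF pow that]] by simp
        also have "cylinder X u \<inter> ((shift ^^ k) -` B \<inter> space M) = cylinder X u \<inter> (shift ^^ k) -` B"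
          using Mp(3) by (auto simp: cylinder_def)
        finally show ?thesis .
      qed
      have finQ: "finite_measure Q"
        unfolding Q_def using fin[OF Mp(4)] pow' by (rule finite_measure.finite_measure_distr)
      have "measure M E \<le> (K / measure M (cylinder X u)) * measure Q E"
      proof (rule cylinder_domination[OF X(1) M.finite_measure_axioms Mp(2) finQ])
        show "sets Q = sets (restrict_space borel X)" by (simp add: Q_def Mp(2))
        show "measure M (cylinder X w) \<le> K / measure M (cylinder X u) * measure Q (cylinder X w)" for w
          using k[of w] pos' by (simp add: Q[OF Mp(4)] field_simps)
      qed (use K E in auto)
      also have "measure Q E \<le> measure M (E \<inter> cylinder X u)"
      proof -
        have "AE x in M. x \<in> cylinder X u \<inter> ((shift ^^ k) -` E \<inter> space M) \<longrightarrow> x \<in> E \<inter> cylinder X u"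
          using AE_funpow_invariant[OF shift dist AE, of k] by eventually_elim auto
        then have "measure M (cylinder X u \<inter> ((shift ^^ k) -` E \<inter> space M)) \<le> measure M (E \<inter> cylinder X u)"
          by (rule M.finite_measure_mono_AE) (use E Mp(4) in auto)
        moreover have "cylinder X u \<inter> ((shift ^^ k) -` E \<inter> space M) = cylinder X u \<inter> (shift ^^ k) -` E"
          using Mp(3) by (auto simp: cylinder_def)
        ultimately show ?thesis using Q[OF E] by simp
      qed
      finally have "measure M E \<le> (K / measure M (cylinder X u)) * measure M (E \<inter> cylinder X u)"
        using K by (simp add: mult_left_mono divide_right_mono)
      then show ?thesis using pos pos' by (simp add: field_simps)
    qed
    have "measure M (space M - E) \<le> (K / measure M E) * measure (density M (indicator E)) (space M - E)"
    proof (rule cylinder_domination[OF X(1) M.finite_measure_axioms Mp(2) fin[OF E]])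
      show "measure M (cylinder X w) \<le> K / measure M E * measure (density M (indicator E)) (cylinder X w)" for w
        using cyl[of w] by (simp add: restr[OF E Mp(4)])
    qed (use K E Mp(2) in auto)
    also have "measure (density M (indicator E)) (space M - E) = 0"
      using restr[OF E, of "space M - E"] E by simp
    finally have "measure M (space M - E) \<le> 0" by simp
    then have "measure M E = 1"
      using M.prob_compl[OF E] M.prob_le_1[of E] by simp
    then show ?thesis ..
  qed simp
qed

section \<open>The two-copy subshift\<close>

lemma shift_full_shift: "x \<in> full_shift d \<Longrightarrow> shift x \<in> full_shift d"
  by (simp add: full_shift_def shift_def)

lemma funpow_shift: "(shift ^^ k) x = (\<lambda>i. x (i + k))"
  by (induction k arbitrary: x) (auto simp: shift_def fun_eq_iff)

lemma birkhoff_sum_first_symbol: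
  assumes "\<And>x. f x = g (x 0)"
  shows "birkhoff_sum f n x = (\<Sum>k<n. g (x k))"
  by (simp add: birkhoff_sum_def funpow_shift assms)

lemma cylinder_nonempty_prefix:
  assumes "cylinder X w \<noteq> {}" obtains x where "x \<in> X" "w = prefix_word x (length w)"
  using assms by (auto simp: cylinder_def)

definition copy_swap :: "nat \<Rightarrow> (nat \<Rightarrow> nat) \<Rightarrow> nat \<Rightarrow> nat" where
  "copy_swap d y = (\<lambda>k. if y k \<le> d then y k + d else y k - d)"

definition copy_forget :: "nat \<Rightarrow> (nat \<Rightarrow> nat) \<Rightarrow> nat \<Rightarrow> nat" where
  "copy_forget d y = (\<lambda>k. if y k \<le> d then y k else y k - d)"

locale two_copies =
  fixes d l :: nat
  assumes l: "1 < l" "l \<le> d"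
begin

text \<open>
  Reading the symbol \<open>i\<close> moves to the first copy of the alphabet exactly in these cases: from the
  first copy by a diagonal matrix, from the second one by an antidiagonal matrix.
\<close>

definition to_first :: "nat \<Rightarrow> bool" where
  "to_first i \<longleftrightarrow> i < l \<or> d + l \<le> i"

lemma trans_mat_eq_1_iff:
  assumes "i \<in> {1..2*d}"
  shows "trans_mat d l i j = 1 \<longleftrightarrow> (j \<le> d \<longleftrightarrow> to_first i)"
  using assms l unfolding trans_mat_def to_first_def by auto

lemma Sigma_A_iff:
  "x \<in> Sigma_A d l \<longleftrightarrow> (\<forall>k. x k \<in> {1..2*d}) \<and> (\<forall>k. x (Suc k) \<le> d \<longleftrightarrow> to_first (x k))"
  unfolding Sigma_A_def full_shift_def using trans_mat_eq_1_iff by blast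

lemma Sigma_A_subset: "Sigma_A d l \<subseteq> full_shift (2 * d)"
  by (auto simp: Sigma_A_def)

lemma Sigma_A_range:
  assumes "x \<in> Sigma_A d l" shows "1 \<le> x k" "x k \<le> 2 * d"
  using assms by (auto simp: Sigma_A_iff)

lemma shift_Sigma_A: "x \<in> Sigma_A d l \<Longrightarrow> shift x \<in> Sigma_A d l"
  by (simp add: Sigma_A_iff shift_def)

lemma to_first_swap:
  assumes "i \<in> {1..2*d}"
  shows "to_first (if i \<le> d then i + d else i - d) \<longleftrightarrow> \<not> to_first i"
  using assms l by (auto simp: to_first_def)

lemma copy_swap_Sigma_A:
  assumes x: "x \<in> Sigma_A d l" shows "copy_swap d x \<in> Sigma_A d l"
  unfolding Sigma_A_iff
proof (intro conjI allI)
  fix k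
  have r: "1 \<le> x k" "x k \<le> 2 * d" "1 \<le> x (Suc k)" using Sigma_A_range[OF x] by auto
  then show "copy_swap d x k \<in> {1..2 * d}"
    unfolding copy_swap_def by auto
  have "copy_swap d x (Suc k) \<le> d \<longleftrightarrow> \<not> x (Suc k) \<le> d"
    using r Sigma_A_range(2)[OF x, of "Suc k"] by (auto simp: copy_swap_def)
  also have "\<dots> \<longleftrightarrow> \<not> to_first (x k)" using x by (simp add: Sigma_A_iff)
  also have "\<dots> \<longleftrightarrow> to_first (copy_swap d x k)"
    using to_first_swap[of "x k"] r by (simp add: copy_swap_def)
  finally show "copy_swap d x (Suc k) \<le> d \<longleftrightarrow> to_first (copy_swap d x k)" .
qed

lemma copy_swap_copy_swap:
  assumes x: "x \<in> Sigma_A d l" shows "copy_swap d (copy_swap d x) = x"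
proof
  fix k show "copy_swap d (copy_swap d x) k = x k"
    using Sigma_A_range[OF x, of k] by (auto simp: copy_swap_def)
qed

lemma copy_swap_first:
  assumes "x \<in> Sigma_A d l" shows "copy_swap d x 0 \<le> d \<longleftrightarrow> \<not> x 0 \<le> d"
  using Sigma_A_range[OF assms, of 0] by (auto simp: copy_swap_def)

lemma copy_forget_copy_swap:
  assumes x: "x \<in> Sigma_A d l" shows "copy_forget d (copy_swap d x) = copy_forget d x"
proof
  fix k show "copy_forget d (copy_swap d x) k = copy_forget d x k"
    using Sigma_A_range[OF x, of k] by (auto simp: copy_forget_def copy_swap_def)
qed

lemma copy_forget_full_shift:
  assumes x: "x \<in> Sigma_A d l" shows "copy_forget d x \<in> full_shift d"
  unfolding full_shift_def
proof (intro CollectI allI)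
  fix k show "copy_forget d x k \<in> {1..d}"
    using Sigma_A_range[OF x, of k] by (auto simp: copy_forget_def)
qed

lemma card_crossings_Suc:
  "card {j. j < Suc m \<and> l \<le> x j} = card {j. j < m \<and> l \<le> x j} + (if l \<le> x m then 1 else 0)"
proof (cases "l \<le> x m")
  case True
  then have "{j. j < Suc m \<and> l \<le> x j} = insert m {j. j < m \<and> l \<le> x j}"
    by (auto simp: less_Suc_eq)
  then show ?thesis using True by simp
next
  case False
  then have "{j. j < Suc m \<and> l \<le> x j} = {j. j < m \<and> l \<le> x j}"
    by (auto simp: less_Suc_eq)
  then show ?thesis using False by simp
qed

lemma tau_le_iff:
  assumes "x \<in> full_shift d"
  shows "tau d l x m \<le> d \<longleftrightarrow> even (card {j. j < m \<and> l \<le> x j})"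
proof -
  have "1 \<le> x m" "x m \<le> d" using assms by (auto simp: full_shift_def)
  then show ?thesis by (simp add: tau_def)
qed

lemma tau_Sigma_A:
  assumes x: "x \<in> full_shift d" shows "tau d l x \<in> Sigma_A d l"
  unfolding Sigma_A_iff
proof (intro conjI allI)
  fix k
  have r: "1 \<le> x k" "x k \<le> d" using x by (auto simp: full_shift_def)
  then show "tau d l x k \<in> {1..2 * d}" by (auto simp: tau_def)
  have "tau d l x (Suc k) \<le> d \<longleftrightarrow> (even (card {j. j < k \<and> l \<le> x j}) \<longleftrightarrow> x k < l)"
    unfolding tau_le_iff[OF x] card_crossings_Suc by auto
  also have "\<dots> \<longleftrightarrow> to_first (tau d l x k)"
    using r l by (auto simp: tau_def to_first_def)
  finally show "tau d l x (Suc k) \<le> d \<longleftrightarrow> to_first (tau d l x k)" .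
qed

lemma tau_first: "x \<in> full_shift d \<Longrightarrow> tau d l x 0 \<le> d"
  by (simp add: tau_le_iff)

lemma copy_forget_tau:
  assumes x: "x \<in> full_shift d" shows "copy_forget d (tau d l x) = x"
proof
  fix k
  have "1 \<le> x k" "x k \<le> d" using x by (auto simp: full_shift_def)
  then show "copy_forget d (tau d l x) k = x k"
    by (simp add: copy_forget_def tau_def)
qed

text \<open>
  A point of \<open>\<Sigma>\<^sub>A\<close> is determined by its symbols without their copies and by the copy in which it
  starts; the later copies follow from the parity of the number of antidiagonal symbols read.
\<close>

lemma tau_copy_forget:
  assumes y: "y \<in> Sigma_A d l" and y0: "y 0 \<le> d"
  shows "tau d l (copy_forget d y) = y"
proof -
  have par: "y m \<le> d \<longleftrightarrow> even (card {j. j < m \<and> l \<le> copy_forget d y j})" for m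
  proof (induction m)
    case (Suc m)
    have "y (Suc m) \<le> d \<longleftrightarrow> to_first (y m)" using y by (simp add: Sigma_A_iff)
    also have "\<dots> \<longleftrightarrow> (y m \<le> d \<longleftrightarrow> copy_forget d y m < l)"
      using l Sigma_A_range[OF y, of m] by (auto simp: to_first_def copy_forget_def)
    finally show ?case
      unfolding card_crossings_Suc Suc.IH by auto
  qed (simp add: y0)
  show ?thesis
    unfolding tau_def par[symmetric] by (auto simp: copy_forget_def fun_eq_iff)
qed

lemma tau_image:
  assumes "E \<subseteq> full_shift d"
  shows "tau d l ` E = {y \<in> Sigma_A d l. y 0 \<le> d \<and> copy_forget d y \<in> E}"
proof (intro set_eqI iffI)
  fix y assume "y \<in> tau d l ` E"
  then obtain x where "x \<in> E" "y = tau d l x" by blast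
  then show "y \<in> {y \<in> Sigma_A d l. y 0 \<le> d \<and> copy_forget d y \<in> E}"
    using assms tau_Sigma_A[of x] tau_first[of x] copy_forget_tau[of x] by auto
next
  fix y assume y: "y \<in> {y \<in> Sigma_A d l. y 0 \<le> d \<and> copy_forget d y \<in> E}"
  then have "y = tau d l (copy_forget d y)" using tau_copy_forget[of y] by simp
  then show "y \<in> tau d l ` E" using y by blast
qed

text \<open>
  The first \<open>n\<close> symbols of \<open>x\<close> and of \<open>\<tau> x\<close> determine each other. The word must be non-empty: the
  empty cylinder word carries no information on the initial copy, and \<open>\<tau>\<close> only reaches the first.
\<close>

lemma tau_image_cylinder:
  assumes x: "x \<in> full_shift d" and n: "1 \<le> n"
  shows "tau d l ` cylinder (full_shift d) (prefix_word x n)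
       = cylinder (Sigma_A d l) (prefix_word (tau d l x) n)"
proof -
  have "(y 0 \<le> d \<and> (\<forall>k<n. copy_forget d y k = x k)) \<longleftrightarrow> (\<forall>k<n. y k = tau d l x k)"
    if y: "y \<in> Sigma_A d l" for y
  proof
    assume *: "y 0 \<le> d \<and> (\<forall>k<n. copy_forget d y k = x k)"
    show "\<forall>k<n. y k = tau d l x k"
    proof (intro allI impI)
      fix k assume k: "k < n"
      then have "{j. j < k \<and> l \<le> copy_forget d y j} = {j. j < k \<and> l \<le> x j}"
        using * by auto
      then have "tau d l (copy_forget d y) k = tau d l x k"
        using * k by (simp add: tau_def)
      then show "y k = tau d l x k" using tau_copy_forget[OF y] * by simp
    qed
  next
    assume *: "\<forall>k<n. y k = tau d l x k"
    then have "y 0 \<le> d" using n tau_first[OF x] by simp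
    moreover have "copy_forget d y k = x k" if "k < n" for k
      using * that fun_cong[OF copy_forget_tau[OF x], of k] by (auto simp: copy_forget_def split: if_splits)
    ultimately show "y 0 \<le> d \<and> (\<forall>k<n. copy_forget d y k = x k)" by blast
  qed
  moreover have "cylinder (full_shift d) (prefix_word x n) \<subseteq> full_shift d"
    by (auto simp: cylinder_def)
  ultimately show ?thesis
    using copy_forget_full_shift by (subst tau_image) (auto simp: cylinder_prefix_word)
qed

text \<open>
  One symbol is enough to pass from any word to any point, since the transitions between the two
  copies form a positive two-by-two matrix; this is where both kinds of matrices have to occur,
  that is, \<open>1 < l \<le> d\<close>.
\<close>

lemma linking_symbol:
  assumes x: "x \<in> Sigma_A d l" and y: "y \<in> Sigma_A d l"
  shows "\<exists>j\<in>{1..2*d}. (\<lambda>k. if k < n then x k else if k = n then j else y (k - Suc n)) \<in> Sigma_A d l"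
proof -
  \<comment> \<open>The symbols 1, l, d + l, d + 1 realise the four combinations of own copy and target copy;
      for \<open>n = 0\<close> no symbol precedes, and the first copy is an arbitrary choice.\<close>
  define in_first where "in_first \<longleftrightarrow> n = 0 \<or> to_first (x (n - 1))"
  define j where "j = (if in_first then (if y 0 \<le> d then 1 else l) else (if y 0 \<le> d then d + l else d + 1))"
  have j: "j \<in> {1..2*d}" "j \<le> d \<longleftrightarrow> in_first" "to_first j \<longleftrightarrow> y 0 \<le> d"
    using l by (auto simp: j_def to_first_def)
  define z where "z = (\<lambda>k. if k < n then x k else if k = n then j else y (k - Suc n))"
  have "z \<in> Sigma_A d l"
    unfolding Sigma_A_iff
  proof (intro conjI allI)
    fix k
    show "z k \<in> {1..2*d}"
      using j(1) x y by (simp add: z_def Sigma_A_iff)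
    consider "Suc k < n" | "Suc k = n" | "k = n" | "n < k" by linarith
    then show "z (Suc k) \<le> d \<longleftrightarrow> to_first (z k)"
    proof cases
      case 1 then show ?thesis using x by (simp add: z_def Sigma_A_iff)
    next
      case 2 then show ?thesis using j(2) by (auto simp: z_def in_first_def)
    next
      case 3 then show ?thesis using j(3) by (simp add: z_def)
    next
      case 4
      then have "Suc k - Suc n = Suc (k - Suc n)" by simp
      then show ?thesis using 4 y by (simp add: z_def Sigma_A_iff)
    qed
  qed
  then show ?thesis using j(1) unfolding z_def by blast
qed

section \<open>Gibbs measures of first-symbol potentials\<close>

text \<open>
  The Gibbs estimate extends to the empty word, for which all three terms reduce to
  \<open>inverse C \<le> 1 \<le> C\<close>.
\<close>

lemma gibbs_measureD:
  assumes "gibbs_measure (Sigma_A d l) f M"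
  obtains C where "1 \<le> C"
    "\<And>x n. x \<in> Sigma_A d l \<Longrightarrow>
       inverse C * exp (birkhoff_sum f n x - real n * top_pressure (Sigma_A d l) f)
         \<le> measure M (cylinder (Sigma_A d l) (prefix_word x n))"
    "\<And>x n. x \<in> Sigma_A d l \<Longrightarrow>
       measure M (cylinder (Sigma_A d l) (prefix_word x n))
         \<le> C * exp (birkhoff_sum f n x - real n * top_pressure (Sigma_A d l) f)"
proof -
  have M: "borel_prob_on (Sigma_A d l) M" using assms by (simp add: gibbs_measure_def)
  interpret prob_space M using borel_prob_onD(1)[OF M] .
  obtain C where C: "1 \<le> C" and b: "\<And>x n. x \<in> Sigma_A d l \<Longrightarrow> 1 \<le> n \<Longrightarrow>
       inverse C * exp (birkhoff_sum f n x - real n * top_pressure (Sigma_A d l) f)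
         \<le> measure M (cylinder (Sigma_A d l) (prefix_word x n)) \<and>
       measure M (cylinder (Sigma_A d l) (prefix_word x n))
         \<le> C * exp (birkhoff_sum f n x - real n * top_pressure (Sigma_A d l) f)"
    using assms unfolding gibbs_measure_def by blast
  have "cylinder (Sigma_A d l) (prefix_word x 0) = space M" for x
    using borel_prob_onD(3)[OF M] by (simp add: cylinder_prefix_word)
  then have 0: "measure M (cylinder (Sigma_A d l) (prefix_word x 0)) = 1" for x
    using prob_space by simp
  show ?thesis
  proof (rule that[OF C])
    fix x n assume x: "x \<in> Sigma_A d l"
    show "inverse C * exp (birkhoff_sum f n x - real n * top_pressure (Sigma_A d l) f)
         \<le> measure M (cylinder (Sigma_A d l) (prefix_word x n))"
      using b[OF x, of n] C 0[of x] by (cases "n = 0") (auto simp: birkhoff_sum_def inverse_le_1_iff)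
    show "measure M (cylinder (Sigma_A d l) (prefix_word x n))
         \<le> C * exp (birkhoff_sum f n x - real n * top_pressure (Sigma_A d l) f)"
      using b[OF x, of n] C 0[of x] by (cases "n = 0") (auto simp: birkhoff_sum_def)
  qed
qed

text \<open>
  For a potential of the first symbol, the Birkhoff sum of the concatenation \<open>u j v\<close> is the sum
  of those of \<open>u\<close> and \<open>v\<close> up to the value at the linking symbol \<open>j\<close>, which takes finitely many
  values. The Gibbs estimates turn this additivity into the quasi-Bernoulli inequality.
\<close>

lemma gibbs_almost_ergodic:
  assumes G: "gibbs_measure (Sigma_A d l) f M" and f: "\<And>x. f x = g (x 0)"
  shows "almost_ergodic shift M"
proof -
  let ?X = "Sigma_A d l"
  let ?P = "top_pressure ?X f"
  have M: "borel_prob_on ?X M" "shift_invariant M" using G by (auto simp: gibbs_measure_def)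
  interpret prob_space M using borel_prob_onD(1)[OF M(1)] .
  obtain C where C: "1 \<le> C"
    and low: "\<And>x n. x \<in> ?X \<Longrightarrow>
       inverse C * exp (birkhoff_sum f n x - real n * ?P) \<le> measure M (cylinder ?X (prefix_word x n))"
    and up: "\<And>x n. x \<in> ?X \<Longrightarrow>
       measure M (cylinder ?X (prefix_word x n)) \<le> C * exp (birkhoff_sum f n x - real n * ?P)"
    using gibbs_measureD[OF G] by metis
  define L where "L = Min (g ` {1..2*d})"
  have L: "L \<le> g j" if "j \<in> {1..2*d}" for j
    unfolding L_def using that by (intro Min_le) auto
  \<comment> \<open>Three Gibbs estimates cost \<open>C\<close> each; the linking symbol costs at most \<open>exp (P - L)\<close>.\<close>
  define K where "K = C ^ 3 * exp (?P - L)"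
  have K: "0 \<le> K" using C by (simp add: K_def)
  show ?thesis
  proof (rule almost_ergodic_if_quasi_Bernoulli[OF Sigma_A_subset shift_Sigma_A M K])
    fix u
    show "\<exists>k. \<forall>v. measure M (cylinder ?X u) * measure M (cylinder ?X v)
                \<le> K * measure M (cylinder ?X u \<inter> (shift ^^ k) -` cylinder ?X v)"
    proof (cases "cylinder ?X u = {}")
      case False
      then obtain x where x: "x \<in> ?X" "u = prefix_word x (length u)"
        using cylinder_nonempty_prefix by blast
      define n where "n = length u"
      have "measure M (cylinder ?X u) * measure M (cylinder ?X v)
                \<le> K * measure M (cylinder ?X u \<inter> (shift ^^ Suc n) -` cylinder ?X v)" for v
      proof (cases "cylinder ?X v = {}")
        case True
        then show ?thesis using K by simp
      next
        case False
        then obtain y where y: "y \<in> ?X" "v = prefix_word y (length v)"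
          using cylinder_nonempty_prefix by blast
        define m where "m = length v"
        obtain j where j: "j \<in> {1..2*d}"
          and z': "(\<lambda>k. if k < n then x k else if k = n then j else y (k - Suc n)) \<in> ?X"
          using linking_symbol[OF x(1) y(1), of n] by blast
        define z where "z = (\<lambda>k. if k < n then x k else if k = n then j else y (k - Suc n))"
        have z: "z \<in> ?X" using z' by (simp add: z_def)
        have u: "cylinder ?X u = {w \<in> ?X. \<forall>k<n. w k = x k}"
          using x(2) cylinder_prefix_word unfolding n_def by metis
        have v: "cylinder ?X v = {w \<in> ?X. \<forall>k<m. w k = y k}"
          using y(2) cylinder_prefix_word unfolding m_def by metis
        have sub: "cylinder ?X (prefix_word z (Suc n + m)) \<subseteq> cylinder ?X u \<inter> (shift ^^ Suc n) -` cylinder ?X v"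
        proof
          fix w assume "w \<in> cylinder ?X (prefix_word z (Suc n + m))"
          then have w: "w \<in> ?X" "\<And>k. k < Suc n + m \<Longrightarrow> w k = z k"
            by (auto simp: cylinder_prefix_word)
          have "w k = x k" if "k < n" for k using w(2)[of k] that by (simp add: z_def)
          moreover have "(shift ^^ Suc n) w k = y k" if "k < m" for k
            unfolding funpow_shift using w(2)[of "k + Suc n"] that by (simp add: z_def)
          moreover have "(shift ^^ i) w \<in> ?X" for i
            using w(1) by (induction i) (auto simp: shift_Sigma_A)
          ultimately show "w \<in> cylinder ?X u \<inter> (shift ^^ Suc n) -` cylinder ?X v"
            using w(1) unfolding u v by blast
        qed
        have meas: "cylinder ?X u \<inter> (shift ^^ Suc n) -` cylinder ?X v \<in> sets M"
        proof -
          have shift: "shift \<in> measurable M M"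
            using shift_measurable[OF shift_Sigma_A] borel_prob_onD(2)[OF M(1)]
            by (simp cong: measurable_cong_sets)
          have "shift ^^ k \<in> measurable M M" for k
            by (induction k) (auto intro: measurable_compose[OF _ shift] simp: comp_def id_def)
          then have "(shift ^^ Suc n) -` cylinder ?X v \<inter> space M \<in> sets M"
            using borel_prob_onD(4)[OF M(1)] by (rule measurable_sets)
          moreover have "cylinder ?X u \<inter> (shift ^^ Suc n) -` cylinder ?X v
              = cylinder ?X u \<inter> ((shift ^^ Suc n) -` cylinder ?X v \<inter> space M)"
            using borel_prob_onD(3)[OF M(1)] by (auto simp: cylinder_def)
          ultimately show ?thesis using borel_prob_onD(4)[OF M(1)] by auto
        qed
        have "birkhoff_sum f (Suc n + m) z = birkhoff_sum f n x + g j + birkhoff_sum f m y"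
        proof -
          have "(\<Sum>k<Suc n + m. g (z k)) = (\<Sum>k<Suc n. g (z k)) + (\<Sum>k<m. g (z (Suc n + k)))"
            by (induction m) (simp_all add: add.assoc)
          then show ?thesis
            unfolding birkhoff_sum_first_symbol[of f g, OF f] by (simp add: z_def)
        qed
        then have S: "birkhoff_sum f n x + L + birkhoff_sum f m y \<le> birkhoff_sum f (Suc n + m) z"
          using L[OF j] by simp
        have "measure M (cylinder ?X u) * measure M (cylinder ?X v)
            \<le> (C * exp (birkhoff_sum f n x - real n * ?P)) * (C * exp (birkhoff_sum f m y - real m * ?P))"
          using up[OF x(1), of n] up[OF y(1), of m] C
          unfolding n_def m_def x(2)[symmetric] y(2)[symmetric] by (intro mult_mono) auto
        also have "\<dots> = K * (inverse C * exp (birkhoff_sum f n x + L + birkhoff_sum f m y - real (Suc n + m) * ?P))"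
        proof -
          have "exp (birkhoff_sum f n x - real n * ?P) * exp (birkhoff_sum f m y - real m * ?P)
              = exp (?P - L) * exp (birkhoff_sum f n x + L + birkhoff_sum f m y - real (Suc n + m) * ?P)"
            unfolding exp_add[symmetric] by (simp add: algebra_simps)
          then show ?thesis
            using C by (simp add: K_def power3_eq_cube)
        qed
        also have "\<dots> \<le> K * (inverse C * exp (birkhoff_sum f (Suc n + m) z - real (Suc n + m) * ?P))"
          using S C K by (intro mult_left_mono) auto
        also have "\<dots> \<le> K * measure M (cylinder ?X (prefix_word z (Suc n + m)))"
          using low[OF z, of "Suc n + m"] K by (rule mult_left_mono)
        also have "\<dots> \<le> K * measure M (cylinder ?X u \<inter> (shift ^^ Suc n) -` cylinder ?X v)"
          using finite_measure_mono[OF sub meas] K by (rule mult_left_mono)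
        finally show ?thesis .
      qed
      then show ?thesis by blast
    qed (use K in auto)
  qed
qed

lemma gibbs_unique:
  assumes M: "gibbs_measure (Sigma_A d l) f M" and N: "gibbs_measure (Sigma_A d l) f N"
    and f: "\<And>x. f x = g (x 0)"
  shows "N = M"
proof -
  let ?X = "Sigma_A d l"
  let ?P = "top_pressure ?X f"
  obtain C where C: "1 \<le> C"
    and low: "\<And>x n. x \<in> ?X \<Longrightarrow>
       inverse C * exp (birkhoff_sum f n x - real n * ?P) \<le> measure M (cylinder ?X (prefix_word x n))"
    using gibbs_measureD[OF M] by metis
  obtain D where D: "1 \<le> D"
    and up: "\<And>x n. x \<in> ?X \<Longrightarrow>
       measure N (cylinder ?X (prefix_word x n)) \<le> D * exp (birkhoff_sum f n x - real n * ?P)"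
    using gibbs_measureD[OF N] by metis
  have "measure N (cylinder ?X w) \<le> (C * D) * measure M (cylinder ?X w)" for w
  proof (cases "cylinder ?X w = {}")
    case False
    then obtain x where x: "x \<in> ?X" "w = prefix_word x (length w)"
      using cylinder_nonempty_prefix by blast
    let ?e = "exp (birkhoff_sum f (length w) x - real (length w) * ?P)"
    have "measure N (cylinder ?X w) \<le> D * ?e" using up[OF x(1), of "length w"] unfolding x(2)[symmetric] .
    also have "\<dots> = (C * D) * (inverse C * ?e)" using C by simp
    also have "\<dots> \<le> (C * D) * measure M (cylinder ?X w)"
      using low[OF x(1), of "length w"] C D unfolding x(2)[symmetric] by (intro mult_left_mono) auto
    finally show ?thesis .
  qed simp
  then show ?thesis
    using M N C D gibbs_almost_ergodic[OF M f] unfolding gibbs_measure_def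
    by (intro almost_ergodic_dominated_eq[OF Sigma_A_subset shift_Sigma_A, of M N "C * D"]) auto
qed

end

section \<open>Exchanging and forgetting the copies\<close>

lemma symbolwise_measurable: "(\<lambda>x k. h (x k)) \<in> borel_measurable (borel :: (nat \<Rightarrow> nat) measure)"
  for h :: "nat \<Rightarrow> nat"
proof (rule measurable_coordinatewise_then_product)
  fix k :: nat
  have "h \<in> borel_measurable borel"
    by (simp add: measurable_cong_sets[OF sets_borel_eq_count_space refl])
  moreover have "(\<lambda>x::nat \<Rightarrow> nat. x k) \<in> borel_measurable borel"
    by (rule borel_measurable_continuous_onI) (rule continuous_on_product_coordinates)
  ultimately show "(\<lambda>x::nat \<Rightarrow> nat. h (x k)) \<in> borel_measurable borel"
    by (rule measurable_compose[rotated])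
qed

lemma shift_invariant_distr:
  assumes M: "shift_invariant M" "shift \<in> measurable M M"
    and N: "shift \<in> measurable N N" and p: "p \<in> measurable M N"
    and comm: "\<And>x. x \<in> space M \<Longrightarrow> p (shift x) = shift (p x)"
  shows "shift_invariant (distr M N p)"
  unfolding shift_invariant_def
proof
  fix E assume "E \<in> sets (distr M N p)"
  then have E: "E \<in> sets N" by simp
  have "emeasure (distr M N p) (shift -` E \<inter> space N)
      = emeasure M (p -` (shift -` E \<inter> space N) \<inter> space M)"
    using p measurable_sets[OF N E] by (rule emeasure_distr)
  also have "p -` (shift -` E \<inter> space N) \<inter> space M = shift -` (p -` E \<inter> space M) \<inter> space M"
    using comm measurable_space[OF p] measurable_space[OF M(2)] by auto
  also have "emeasure M \<dots> = emeasure M (p -` E \<inter> space M)"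
    using M(1) measurable_sets[OF p E] unfolding shift_invariant_def by blast
  also have "\<dots> = emeasure (distr M N p) E"
    using p E by (rule emeasure_distr[symmetric])
  finally show "emeasure (distr M N p) (shift -` E \<inter> space (distr M N p)) = emeasure (distr M N p) E"
    by simp
qed

lemma almost_ergodic_distr:
  assumes M: "almost_ergodic T M" and p: "p \<in> measurable M N"
    and comm: "\<And>x. x \<in> space M \<Longrightarrow> p (T x) = S (p x)"
    and T: "T \<in> measurable M M"
  shows "almost_ergodic S (distr M N p)"
  unfolding almost_ergodic_def
proof (intro ballI impI)
  fix E assume "E \<in> sets (distr M N p)" and AE: "AE x in distr M N p. S x \<in> E \<longrightarrow> x \<in> E"
  then have E: "E \<in> sets N" by simp
  have "AE x in M. S (p x) \<in> E \<longrightarrow> p x \<in> E"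
    using AE_distrD[OF p AE] .
  then have "AE x in M. T x \<in> p -` E \<inter> space M \<longrightarrow> x \<in> p -` E \<inter> space M"
    using AE_space by eventually_elim (auto simp: comm)
  then show "measure (distr M N p) E = 0 \<or> measure (distr M N p) E = 1"
    using M measurable_sets[OF p E] unfolding almost_ergodic_def measure_distr[OF p E] by blast
qed

lemma shift_ergodic_if_almost_ergodic:
  assumes "almost_ergodic shift M" shows "shift_ergodic M"
  unfolding shift_ergodic_def
proof (intro ballI impI)
  fix E assume E: "E \<in> sets M" "shift -` E \<inter> space M = E"
  then have "AE x in M. shift x \<in> E \<longrightarrow> x \<in> E" by (intro AE_I2) blast
  then show "measure M E = 0 \<or> measure M E = 1"
    using assms E(1) by (auto simp: almost_ergodic_def)
qed

context two_copies
begin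

lemma copy_swap_measurable:
  "copy_swap d \<in> measurable (restrict_space borel (Sigma_A d l)) (restrict_space borel (Sigma_A d l))"
proof (rule measurable_restrict_space3)
  show "copy_swap d \<in> borel_measurable borel"
    using symbolwise_measurable[of "\<lambda>i. if i \<le> d then i + d else i - d"]
    by (simp add: copy_swap_def[abs_def])
qed (use copy_swap_Sigma_A in auto)

lemma copy_forget_measurable:
  "copy_forget d \<in> measurable (restrict_space borel (Sigma_A d l)) (restrict_space borel (full_shift d))"
proof (rule measurable_restrict_space3)
  show "copy_forget d \<in> borel_measurable borel"
    using symbolwise_measurable[of "\<lambda>i. if i \<le> d then i else i - d"]
    by (simp add: copy_forget_def[abs_def])
qed (use copy_forget_full_shift in auto)

lemma copy_swap_image_cylinder:
  assumes x: "x \<in> Sigma_A d l"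
  shows "copy_swap d ` cylinder (Sigma_A d l) (prefix_word x n)
       = cylinder (Sigma_A d l) (prefix_word (copy_swap d x) n)"
proof -
  have sub: "copy_swap d ` cylinder (Sigma_A d l) (prefix_word x n)
       \<subseteq> cylinder (Sigma_A d l) (prefix_word (copy_swap d x) n)" for x
    using copy_swap_Sigma_A by (auto simp: cylinder_prefix_word copy_swap_def)
  have "y \<in> copy_swap d ` cylinder (Sigma_A d l) (prefix_word x n)"
    if y: "y \<in> cylinder (Sigma_A d l) (prefix_word (copy_swap d x) n)" for y
  proof
    have "y \<in> Sigma_A d l" using y by (simp add: cylinder_def)
    then show "y = copy_swap d (copy_swap d y)" by (simp add: copy_swap_copy_swap)
    show "copy_swap d y \<in> cylinder (Sigma_A d l) (prefix_word x n)"
      using sub[of "copy_swap d x"] y copy_swap_copy_swap[OF x] by auto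
  qed
  then show ?thesis using sub[of x] by blast
qed

lemma birkhoff_sum_copy_swap:
  assumes f: "\<And>x. x \<in> Sigma_A d l \<Longrightarrow> f (copy_swap d x) = f' x" and x: "x \<in> Sigma_A d l"
  shows "birkhoff_sum f n (copy_swap d x) = birkhoff_sum f' n x"
proof -
  have "(shift ^^ k) (copy_swap d x) = copy_swap d ((shift ^^ k) x)" for k
    by (simp add: funpow_shift copy_swap_def)
  moreover have "(shift ^^ k) x \<in> Sigma_A d l" for k
    by (induction k) (auto simp: x shift_Sigma_A)
  ultimately show ?thesis by (simp add: birkhoff_sum_def f)
qed

lemma top_pressure_copy_swap:
  assumes f: "\<And>x. x \<in> Sigma_A d l \<Longrightarrow> f (copy_swap d x) = f' x"
  shows "top_pressure (Sigma_A d l) f' = top_pressure (Sigma_A d l) f"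
proof -
  define \<sigma> where "\<sigma> i = (if i \<le> d then i + d else i - d)" for i
  have \<sigma>: "map \<sigma> (prefix_word x n) = prefix_word (copy_swap d x) n" for x n
    by (simp add: prefix_word_def copy_swap_def \<sigma>_def)
  have "(\<Sum>w\<in>(\<lambda>x. prefix_word x n) ` Sigma_A d l. SUP x\<in>cylinder (Sigma_A d l) w. exp (birkhoff_sum f' n x))
      = (\<Sum>w\<in>(\<lambda>x. prefix_word x n) ` Sigma_A d l. SUP x\<in>cylinder (Sigma_A d l) w. exp (birkhoff_sum f n x))" for n
  proof (rule sum.reindex_bij_witness[of _ "map \<sigma>" "map \<sigma>"])
    fix w assume "w \<in> (\<lambda>x. prefix_word x n) ` Sigma_A d l"
    then obtain x where x: "x \<in> Sigma_A d l" "w = prefix_word x n" by blast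
    then show "map \<sigma> (map \<sigma> w) = w" by (simp only: \<sigma> copy_swap_copy_swap)
    then show "map \<sigma> (map \<sigma> w) = w" .
    show "map \<sigma> w \<in> (\<lambda>x. prefix_word x n) ` Sigma_A d l"
      unfolding x(2) \<sigma> using copy_swap_Sigma_A[OF x(1)] by (rule imageI)
    then show "map \<sigma> w \<in> (\<lambda>x. prefix_word x n) ` Sigma_A d l" .
    have "birkhoff_sum f n (copy_swap d y) = birkhoff_sum f' n y" if "y \<in> cylinder (Sigma_A d l) w" for y
      using that by (intro birkhoff_sum_copy_swap[of f f', OF f]) (auto simp: cylinder_def)
    then show "(SUP x\<in>cylinder (Sigma_A d l) (map \<sigma> w). exp (birkhoff_sum f n x))
        = (SUP x\<in>cylinder (Sigma_A d l) w. exp (birkhoff_sum f' n x))"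
      unfolding x(2) \<sigma> copy_swap_image_cylinder[OF x(1), symmetric]
      by (simp add: image_image x(2) cong: image_cong_simp)
  qed
  then show ?thesis unfolding top_pressure_def by simp
qed

text \<open>
  The exchange is an automorphism of the subshift, so it carries Gibbs measures to Gibbs measures.
\<close>

lemma gibbs_measure_copy_swap:
  assumes G: "gibbs_measure (Sigma_A d l) f M"
    and f: "\<And>x. x \<in> Sigma_A d l \<Longrightarrow> f (copy_swap d x) = f' x"
  shows "gibbs_measure (Sigma_A d l) f' (distr M M (copy_swap d))"
proof -
  let ?X = "Sigma_A d l"
  have M: "borel_prob_on ?X M" "shift_invariant M" using G by (auto simp: gibbs_measure_def)
  note Mp = borel_prob_onD[OF M(1)]
  interpret prob_space M by (rule Mp)
  have swap: "copy_swap d \<in> measurable M M"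
    using copy_swap_measurable Mp(2) by (simp cong: measurable_cong_sets)
  have shift: "shift \<in> measurable M M"
    using shift_measurable[OF shift_Sigma_A] Mp(2) by (simp cong: measurable_cong_sets)
  have "borel_prob_on ?X (distr M M (copy_swap d))"
    using Mp(2) prob_space_distr[OF swap] by (simp add: borel_prob_on_def)
  moreover have "shift_invariant (distr M M (copy_swap d))"
    by (rule shift_invariant_distr[OF M(2) shift shift swap]) (simp add: copy_swap_def shift_def)
  moreover have "\<exists>C\<ge>1. \<forall>x\<in>?X. \<forall>n\<ge>1.
        inverse C * exp (birkhoff_sum f' n x - real n * top_pressure ?X f')
          \<le> measure (distr M M (copy_swap d)) (cylinder ?X (prefix_word x n)) \<and>
        measure (distr M M (copy_swap d)) (cylinder ?X (prefix_word x n))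
          \<le> C * exp (birkhoff_sum f' n x - real n * top_pressure ?X f')"
  proof -
    have cyl: "measure (distr M M (copy_swap d)) (cylinder ?X (prefix_word x n))
        = measure M (cylinder ?X (prefix_word (copy_swap d x) n))" if x: "x \<in> ?X" for x n
    proof -
      have "copy_swap d -` cylinder ?X (prefix_word x n) \<inter> space M
          = copy_swap d ` cylinder ?X (prefix_word x n)"
      proof (intro set_eqI iffI)
        fix y assume y: "y \<in> copy_swap d -` cylinder ?X (prefix_word x n) \<inter> space M"
        then have "copy_swap d (copy_swap d y) \<in> copy_swap d ` cylinder ?X (prefix_word x n)"
          by (intro imageI) simp
        moreover have "copy_swap d (copy_swap d y) = y"
          using y Mp(3) by (intro copy_swap_copy_swap) blast
        ultimately show "y \<in> copy_swap d ` cylinder ?X (prefix_word x n)"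
          by metis
      next
        fix y assume "y \<in> copy_swap d ` cylinder ?X (prefix_word x n)"
        then obtain z where z: "z \<in> cylinder ?X (prefix_word x n)" "y = copy_swap d z" by blast
        then have "z \<in> ?X" by (simp add: cylinder_def)
        then show "y \<in> copy_swap d -` cylinder ?X (prefix_word x n) \<inter> space M"
          using z(1) unfolding z(2) Mp(3) by (simp add: copy_swap_copy_swap copy_swap_Sigma_A)
      qed
      then show ?thesis
        unfolding measure_distr[OF swap Mp(4)] copy_swap_image_cylinder[OF x] by (rule arg_cong)
    qed
    obtain C where C: "1 \<le> C" and b: "\<forall>x\<in>?X. \<forall>n\<ge>1.
        inverse C * exp (birkhoff_sum f n x - real n * top_pressure ?X f)
          \<le> measure M (cylinder ?X (prefix_word x n)) \<and>
        measure M (cylinder ?X (prefix_word x n))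
          \<le> C * exp (birkhoff_sum f n x - real n * top_pressure ?X f)"
      using G unfolding gibbs_measure_def by blast
    show ?thesis
    proof (intro exI[of _ C] conjI C ballI allI impI)
      fix x n assume x: "x \<in> ?X" and n: "1 \<le> (n::nat)"
      have p: "top_pressure ?X f' = top_pressure ?X f"
        using f by (rule top_pressure_copy_swap)
      have S: "birkhoff_sum f' n x = birkhoff_sum f n (copy_swap d x)"
        by (rule birkhoff_sum_copy_swap[of f f', symmetric]) (use f x in blast)+
      note b' = bspec[OF b copy_swap_Sigma_A[OF x], rule_format, OF n]
      show "inverse C * exp (birkhoff_sum f' n x - real n * top_pressure ?X f')
          \<le> measure (distr M M (copy_swap d)) (cylinder ?X (prefix_word x n))"
        using b' unfolding cyl[OF x] p S by (rule conjunct1)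
      show "measure (distr M M (copy_swap d)) (cylinder ?X (prefix_word x n))
          \<le> C * exp (birkhoff_sum f' n x - real n * top_pressure ?X f')"
        using b' unfolding cyl[OF x] p S by (rule conjunct2)
    qed
  qed
  ultimately show ?thesis unfolding gibbs_measure_def by blast
qed

text \<open>
  The preimage of \<open>E\<close> under the forgetful map splits according to the copy of the initial symbol:
  the part starting in the first copy is \<open>\<tau>(E)\<close>, the other part is its image under the exchange.
\<close>

lemma emeasure_copy_forget:
  assumes M: "borel_prob_on (Sigma_A d l) M"
    and E: "E \<in> sets (restrict_space borel (full_shift d))"
  shows "emeasure (distr M (restrict_space borel (full_shift d)) (copy_forget d)) E
       = emeasure M (tau d l ` E) + emeasure (distr M M (copy_swap d)) (tau d l ` E)"
proof -
  let ?B = "restrict_space borel (full_shift d)"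
  let ?L = "{y \<in> Sigma_A d l. y 0 \<le> d}"
  let ?F = "copy_forget d -` E \<inter> space M"
  note Mp = borel_prob_onD[OF M]
  have swap: "copy_swap d \<in> measurable M M"
    using copy_swap_measurable Mp(2) by (simp cong: measurable_cong_sets)
  have forget: "copy_forget d \<in> measurable M ?B"
    using copy_forget_measurable measurable_cong_sets[OF Mp(2) refl] by auto
  have "?L = (\<Union>i\<le>d. cylinder (Sigma_A d l) [i])"
    by (auto simp: cylinder_def prefix_word_def)
  then have first: "?L \<in> sets M" using Mp(4) by auto
  have sub: "E \<subseteq> full_shift d"
    using sets.sets_into_space[OF E] by (simp add: space_restrict_space)
  have F: "?F \<in> sets M" using forget E by (rule measurable_sets)
  have tau: "tau d l ` E = ?F \<inter> ?L"
    using tau_image[OF sub] Mp(3) by auto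
  have tauM: "tau d l ` E \<in> sets M" unfolding tau using F first by (rule sets.Int)
  have "copy_swap d -` (tau d l ` E) \<inter> space M = ?F - ?L"
    unfolding tau_image[OF sub] Mp(3)
  proof (rule set_eqI)
    fix y
    show "y \<in> copy_swap d -` {y \<in> Sigma_A d l. y 0 \<le> d \<and> copy_forget d y \<in> E} \<inter> Sigma_A d l
      \<longleftrightarrow> y \<in> copy_forget d -` E \<inter> Sigma_A d l - ?L"
    proof (cases "y \<in> Sigma_A d l")
      case True
      show ?thesis
        using copy_swap_Sigma_A[OF True] copy_forget_copy_swap[OF True] copy_swap_first[OF True] True
        by auto
    qed simp
  qed
  then have "emeasure (distr M M (copy_swap d)) (tau d l ` E) = emeasure M (?F - ?L)"
    using emeasure_distr[OF swap tauM] by simp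
  moreover have "emeasure M (?F \<inter> ?L) + emeasure M (?F - ?L)
      = emeasure M ((?F \<inter> ?L) \<union> (?F - ?L))"
    by (rule plus_emeasure[OF sets.Int[OF F first] sets.Diff[OF F first]]) blast
  moreover have "(?F \<inter> ?L) \<union> (?F - ?L) = ?F"
    by blast
  ultimately show ?thesis
    unfolding emeasure_distr[OF forget E] tau by simp
qed

lemma nu_eq_distr:
  assumes M: "borel_prob_on (Sigma_A d l) M"
  shows "nu d l M (distr M M (copy_swap d))
       = distr M (restrict_space borel (full_shift d)) (copy_forget d)"
proof -
  let ?B = "restrict_space borel (full_shift d)"
  have space_B: "space ?B = full_shift d" by (simp add: space_restrict_space)
  have "nu d l M (distr M M (copy_swap d))
      = measure_of (full_shift d) (sets ?B) (emeasure (distr M ?B (copy_forget d)))"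
    unfolding nu_def
  proof (rule measure_of_eq)
    show "sets ?B \<subseteq> Pow (full_shift d)" using sets.space_closed[of ?B] unfolding space_B .
    fix E assume "E \<in> sigma_sets (full_shift d) (sets ?B)"
    then have "E \<in> sets ?B"
      using sets.sigma_sets_eq[of ?B] unfolding space_B by blast
    then show "emeasure M (tau d l ` E) + emeasure (distr M M (copy_swap d)) (tau d l ` E)
      = emeasure (distr M ?B (copy_forget d)) E"
      by (rule emeasure_copy_forget[OF M, symmetric])
  qed
  also have "\<dots> = distr M ?B (copy_forget d)"
    using measure_of_of_measure[of "distr M ?B (copy_forget d)"] unfolding space_distr sets_distr space_B .
  finally show ?thesis .
qed

end

section \<open>Singular values and row weights\<close>

definition diag2 :: "real \<Rightarrow> real \<Rightarrow> real^2^2" where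
  "diag2 p q = vector [vector [p, 0], vector [0, q]]"

definition antidiag2 :: "real \<Rightarrow> real \<Rightarrow> real^2^2" where
  "antidiag2 p q = vector [vector [0, p], vector [q, 0]]"

text \<open>
  The non-zero entry of the first row of \<open>A\<^sub>w\<close>. An antidiagonal factor passes on to the second row
  of the remaining product, and exchanging \<open>a\<close> with \<open>b\<close> exchanges the roles of the rows; so the
  entry of the second row of \<open>A\<^sub>w\<close> is \<open>row_entry l b a w\<close>.
\<close>

fun row_entry :: "nat \<Rightarrow> (nat \<Rightarrow> real) \<Rightarrow> (nat \<Rightarrow> real) \<Rightarrow> nat list \<Rightarrow> real" where
  "row_entry l a b [] = 1"
| "row_entry l a b (i # w) = a i * (if i < l then row_entry l a b w else row_entry l b a w)"

lemma diag2_mult: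
  "diag2 p q ** diag2 p' q' = diag2 (p * p') (q * q')"
  "diag2 p q ** antidiag2 p' q' = antidiag2 (p * p') (q * q')"
  "antidiag2 p q ** diag2 p' q' = antidiag2 (p * q') (q * p')"
  "antidiag2 p q ** antidiag2 p' q' = diag2 (p * q') (q * p')"
  by (simp_all add: diag2_def antidiag2_def vec_eq_iff matrix_matrix_mult_def sum_2 forall_2)

lemma transpose_diag2: "transpose (diag2 p q) = diag2 p q" "transpose (antidiag2 p q) = antidiag2 q p"
  by (simp_all add: diag2_def antidiag2_def vec_eq_iff transpose_def forall_2)

lemma A_prod_cases:
  "A_prod l a b w = diag2 (row_entry l a b w) (row_entry l b a w)
   \<or> A_prod l a b w = antidiag2 (row_entry l a b w) (row_entry l b a w)"
proof (induction w)
  case Nil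
  have "mat 1 = diag2 1 1"
    by (simp add: diag2_def vec_eq_iff mat_def forall_2)
  then show ?case by (simp add: A_prod_def)
next
  case (Cons i w)
  have "A_mat l a b i = (if i < l then diag2 (a i) (b i) else antidiag2 (a i) (b i))"
    by (simp add: A_mat_def diag2_def antidiag2_def)
  moreover have "A_prod l a b (i # w) = A_mat l a b i ** A_prod l a b w"
    by (simp add: A_prod_def)
  ultimately show ?case using Cons.IH by (auto simp: diag2_mult)
qed

lemma eigenvalues_diag2:
  "{r. \<exists>v. v \<noteq> 0 \<and> diag2 p q *v v = r *\<^sub>R v} = {p, q}"
proof (intro set_eqI iffI)
  fix r assume "r \<in> {r. \<exists>v. v \<noteq> 0 \<and> diag2 p q *v v = r *\<^sub>R v}"
  then obtain v :: "real^2" where v: "v \<noteq> 0" "diag2 p q *v v = r *\<^sub>R v" by blast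
  have "p * v $ 1 = r * v $ 1" "q * v $ 2 = r * v $ 2"
    using arg_cong[OF v(2), of "\<lambda>u. u $ 1"] arg_cong[OF v(2), of "\<lambda>u. u $ 2"]
    by (simp_all add: diag2_def matrix_vector_mult_def sum_2)
  moreover have "v $ 1 \<noteq> 0 \<or> v $ 2 \<noteq> 0" using v(1) by (auto simp: vec_eq_iff forall_2)
  ultimately show "r \<in> {p, q}" by auto
next
  fix r assume "r \<in> {p, q}"
  then consider "r = p" | "r = q" by blast
  then show "r \<in> {r. \<exists>v. v \<noteq> 0 \<and> diag2 p q *v v = r *\<^sub>R v}"
  proof cases
    case 1
    let ?v = "vector [1, 0] :: real^2"
    have "?v \<noteq> 0" "diag2 p q *v ?v = r *\<^sub>R ?v"
      using 1 by (auto simp: vec_eq_iff forall_2 diag2_def matrix_vector_mult_def sum_2)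
    then show ?thesis by blast
  next
    case 2
    let ?v = "vector [0, 1] :: real^2"
    have "?v \<noteq> 0" "diag2 p q *v ?v = r *\<^sub>R ?v"
      using 2 by (auto simp: vec_eq_iff forall_2 diag2_def matrix_vector_mult_def sum_2)
    then show ?thesis by blast
  qed
qed

lemma singular_values_A_prod:
  assumes "0 < row_entry l a b w" "0 < row_entry l b a w"
  shows "singular_values (A_prod l a b w) = {row_entry l a b w, row_entry l b a w}"
proof -
  let ?p = "row_entry l a b w" and ?q = "row_entry l b a w"
  have sv: "singular_values M = sqrt ` {r. \<exists>v. v \<noteq> 0 \<and> (transpose M ** M) *v v = r *\<^sub>R v}" for M
    unfolding singular_values_def by blast
  from A_prod_cases[of l a b w] show ?thesis
  proof
    assume "A_prod l a b w = diag2 ?p ?q"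
    then show ?thesis
      using assms by (simp add: sv transpose_diag2 diag2_mult eigenvalues_diag2)
  next
    assume "A_prod l a b w = antidiag2 ?p ?q"
    then show ?thesis
      using assms by (auto simp add: sv transpose_diag2 diag2_mult eigenvalues_diag2)
  qed
qed

text \<open>
  The singular value function with \<open>p\<close> and \<open>q\<close> in the places of the larger and of the smaller
  singular value, whatever their order. The potentials \<open>f\<^sub>1\<close> and \<open>f\<^sub>2\<close> are logarithms of
  these weights.
\<close>

definition row_weight :: "real \<Rightarrow> real \<Rightarrow> real \<Rightarrow> real" where
  "row_weight s p q = (if s < 1 then p powr s else p * q powr (s - 1))"

text \<open>
  For \<open>s \<ge> 1\<close> the quotient of the two weights is \<open>(p / q) powr (2 - s)\<close>; this uses \<open>s < 2\<close>.
\<close>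

lemma row_weight_mono:
  assumes s: "0 < s" "s < 2" and q: "0 < q" "q \<le> p"
  shows "row_weight s q p \<le> row_weight s p q"
proof (cases "s < 1")
  case True
  then show ?thesis using s q by (simp add: row_weight_def powr_mono2)
next
  case False
  have "q powr 1 * p powr (s - 1) = q powr (s - 1) * (q powr (2 - s) * p powr (s - 1))"
    using q by (simp add: powr_add[symmetric] mult.assoc[symmetric])
  also have "\<dots> \<le> q powr (s - 1) * (p powr (2 - s) * p powr (s - 1))"
    using s q by (intro mult_left_mono mult_right_mono powr_mono2) auto
  also have "\<dots> = p powr 1 * q powr (s - 1)"
    using q by (simp add: powr_add[symmetric])
  finally show ?thesis using False q by (simp add: row_weight_def)
qed

text \<open>
  The correctly ordered assignment of the two entries to the two places is the larger one.
\<close>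

lemma phi_eq_max_row_weight:
  assumes s: "0 < s" "s < 2" and pos: "0 < row_entry l a b w" "0 < row_entry l b a w"
  shows "phi l a b s w
       = max (row_weight s (row_entry l a b w) (row_entry l b a w))
             (row_weight s (row_entry l b a w) (row_entry l a b w))"
proof -
  let ?p = "row_entry l a b w" and ?q = "row_entry l b a w"
  have "alpha1 l a b w = max ?p ?q" "alpha2 l a b w = min ?p ?q"
    by (simp_all add: alpha1_def alpha2_def singular_values_A_prod[OF pos])
  then have "phi l a b s w = row_weight s (max ?p ?q) (min ?p ?q)"
    by (simp add: phi_def row_weight_def)
  also have "\<dots> = max (row_weight s ?p ?q) (row_weight s ?q ?p)"
    using row_weight_mono[OF s pos(1), of ?q] row_weight_mono[OF s pos(2), of ?p]
    by (cases "?p \<le> ?q") (auto simp: max_def min_def)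
  finally show ?thesis .
qed

lemma row_entry_pos:
  assumes "\<And>i. i \<in> {1..d} \<Longrightarrow> 0 < a i" "\<And>i. i \<in> {1..d} \<Longrightarrow> 0 < b i" "set w \<subseteq> {1..d}"
  shows "0 < row_entry l a b w \<and> 0 < row_entry l b a w"
  using assms(3) by (induction w) (auto simp: assms(1,2))

lemma f2_eq_f1: "f2 d a b s = f1 d b a s"
  by (simp add: f1_def f2_def fun_eq_iff)

context two_copies
begin

lemma f1_copy_swap:
  assumes "x \<in> Sigma_A d l" shows "f1 d a b s (copy_swap d x) = f2 d a b s x"
  using Sigma_A_range[OF assms, of 0] by (auto simp: f1_def f2_def copy_swap_def)

text \<open>
  After an antidiagonal first symbol, \<open>\<tau> x\<close> continues in the second copy, whereas \<open>\<tau>\<close> applied to the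
  shifted point restarts in the first.
\<close>

lemma shift_tau:
  assumes x: "x \<in> full_shift d"
  shows "shift (tau d l x) = (if x 0 < l then tau d l (shift x) else copy_swap d (tau d l (shift x)))"
proof -
  define y where "y = shift (tau d l x)"
  have y: "y \<in> Sigma_A d l" unfolding y_def using x by (intro shift_Sigma_A tau_Sigma_A)
  have "copy_forget d y = shift (copy_forget d (tau d l x))"
    by (simp add: y_def copy_forget_def shift_def)
  then have forget: "copy_forget d y = shift x" using copy_forget_tau[OF x] by simp
  have y0: "y 0 \<le> d \<longleftrightarrow> x 0 < l"
    using tau_le_iff[OF x, of 1] by (simp add: y_def shift_def card_crossings_Suc[of 0 x, simplified])
  show ?thesis
  proof (cases "x 0 < l")
    case True
    then show ?thesis using tau_copy_forget[OF y] y0 forget by (simp add: y_def)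
  next
    case False
    then have "tau d l (copy_forget d (copy_swap d y)) = copy_swap d y"
      using y0 by (intro tau_copy_forget copy_swap_Sigma_A y) (simp add: copy_swap_first[OF y])
    then have "copy_swap d (tau d l (shift x)) = y"
      using copy_forget_copy_swap[OF y] forget copy_swap_copy_swap[OF y] by simp
    then show ?thesis using False by (simp add: y_def)
  qed
qed

text \<open>
  The first symbol splits off both from the matrix product and from the Birkhoff sum. If it is
  antidiagonal, the exchange of the copies replaces \<open>f\<^sub>1\<close> by \<open>f\<^sub>2\<close>, which is \<open>f\<^sub>1\<close> with
  \<open>a\<close> and \<open>b\<close> interchanged; hence the induction has to range over \<open>a\<close> and \<open>b\<close>.
\<close>

lemma exp_birkhoff_sum_tau:
  assumes "\<And>i. i \<in> {1..d} \<Longrightarrow> 0 < a i" "\<And>i. i \<in> {1..d} \<Longrightarrow> 0 < b i" "x \<in> full_shift d"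
  shows "exp (birkhoff_sum (f1 d a b s) n (tau d l x))
       = row_weight s (row_entry l a b (prefix_word x n)) (row_entry l b a (prefix_word x n))"
  using assms
proof (induction n arbitrary: x a b)
  case 0
  then show ?case by (simp add: birkhoff_sum_def prefix_word_def row_weight_def)
next
  case (Suc n)
  define y where "y = tau d l (shift x)"
  define w where "w = prefix_word (shift x) n"
  have x: "x \<in> full_shift d" "shift x \<in> full_shift d"
    using Suc.prems(3) by (auto simp: shift_full_shift)
  have x0: "x 0 \<in> {1..d}" using x(1) by (simp add: full_shift_def)
  have y: "y \<in> Sigma_A d l" unfolding y_def using x(2) by (rule tau_Sigma_A)
  have pos: "0 < a (x 0)" "0 < b (x 0)" using Suc.prems(1,2) x0 by auto
  have pw: "0 < row_entry l a b w" "0 < row_entry l b a w"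
    using row_entry_pos[of d a b w l] Suc.prems(1,2) prefix_word_in_words[OF x(2), of n]
    by (auto simp: w_def words_def)
  have prefix: "prefix_word x (Suc n) = x 0 # w"
    unfolding prefix_word_def w_def by (simp add: upt_conv_Cons map_Suc_upt[symmetric] shift_def comp_def del: upt_Suc)
  have "birkhoff_sum (f1 d a b s) (Suc n) (tau d l x)
      = f1 d a b s (tau d l x) + birkhoff_sum (f1 d a b s) n (shift (tau d l x))"
    unfolding birkhoff_sum_def by (simp add: sum.lessThan_Suc_shift funpow_swap1 del: sum.lessThan_Suc)
  also have "f1 d a b s (tau d l x) = ln (row_weight s (a (x 0)) (b (x 0)))"
    using x0 pos by (simp add: f1_def tau_def row_weight_def ln_powr ln_mult)
  also have "exp (ln (row_weight s (a (x 0)) (b (x 0))) + birkhoff_sum (f1 d a b s) n (shift (tau d l x)))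
      = row_weight s (a (x 0)) (b (x 0)) * exp (birkhoff_sum (f1 d a b s) n (shift (tau d l x)))"
    using pos by (simp add: exp_add row_weight_def)
  also have "exp (birkhoff_sum (f1 d a b s) n (shift (tau d l x)))
      = (if x 0 < l then row_weight s (row_entry l a b w) (row_entry l b a w)
         else row_weight s (row_entry l b a w) (row_entry l a b w))"
  proof (cases "x 0 < l")
    case True
    then show ?thesis
      using Suc.IH[of a b "shift x"] Suc.prems(1,2) x(2) shift_tau[OF x(1)] by (simp add: w_def)
  next
    case False
    have "birkhoff_sum (f1 d a b s) n (copy_swap d y) = birkhoff_sum (f2 d a b s) n y"
      using f1_copy_swap y by (rule birkhoff_sum_copy_swap)
    then show ?thesis
      using False Suc.IH[of b a "shift x"] Suc.prems(1,2) x(2) shift_tau[OF x(1)]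
      by (simp add: w_def f2_eq_f1 y_def)
  qed
  finally show ?case
    unfolding prefix using pos pw
    by (cases "x 0 < l"; cases "s < 1")
       (simp_all add: row_weight_def powr_mult less_imp_le mult_ac)
qed

end

section \<open>Pressure and the Kaenmaki measure\<close>

lemma words_eq_prefix_word:
  assumes "w \<in> words d n" "1 \<le> d"
  obtains x where "x \<in> full_shift d" "w = prefix_word x n"
proof
  \<comment> \<open>Any symbol of the alphabet may continue the word.\<close>
  show "(\<lambda>k. if k < n then w ! k else 1) \<in> full_shift d"
    unfolding full_shift_def
  proof (intro CollectI allI)
    fix k
    have "w ! k \<in> {1..d}" if "k < n" 
      using assms(1) that nth_mem[of k w] unfolding words_def by blast
    then show "(if k < n then w ! k else 1) \<in> {1..d}" using assms(2) by simp
  qed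
  show "w = prefix_word (\<lambda>k. if k < n then w ! k else 1) n"
    using assms(1) by (auto simp: prefix_word_def words_def intro!: nth_equalityI)
qed

lemma lim_ln_over_n:
  fixes S :: "nat \<Rightarrow> real"
  assumes C: "1 \<le> C"
    and low: "\<And>n. 1 \<le> n \<Longrightarrow> inverse C * exp (real n * P) \<le> S n"
    and up: "\<And>n. 1 \<le> n \<Longrightarrow> S n \<le> C * exp (real n * P)"
  shows "lim (\<lambda>n. ln (S n) / real n) = P"
proof (rule limI)
  show "(\<lambda>n. ln (S n) / real n) \<longlonglongrightarrow> P"
  proof (rule tendsto_sandwich)
    have bounds: "- ln C / real n + P \<le> ln (S n) / real n \<and> ln (S n) / real n \<le> ln C / real n + P"
      if n: "1 \<le> n" for n
    proof -
      have pos: "0 < inverse C * exp (real n * P)" using C by simp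
      have "ln (inverse C * exp (real n * P)) \<le> ln (S n)"
        using pos low[OF n] by simp
      moreover have "ln (S n) \<le> ln (C * exp (real n * P))"
        using less_le_trans[OF pos low[OF n]] up[OF n] C by simp
      moreover have "ln (inverse C * exp (real n * P)) = - ln C + real n * P"
        using C by (simp add: ln_mult ln_inverse)
      moreover have "ln (C * exp (real n * P)) = ln C + real n * P"
        using C by (simp add: ln_mult)
      ultimately have "- ln C + real n * P \<le> ln (S n)" "ln (S n) \<le> ln C + real n * P"
        by linarith+
      moreover have "- ln C / real n + P = (- ln C + real n * P) / real n"
        "ln C / real n + P = (ln C + real n * P) / real n"
        using n by (simp_all add: add_divide_distrib diff_divide_distrib)
      ultimately show ?thesis by (simp add: divide_right_mono)
    qed
    show "\<forall>\<^sub>F n in sequentially. - ln C / real n + P \<le> ln (S n) / real n"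
      by (rule eventually_mono[OF eventually_ge_at_top[of "1::nat"]]) (use bounds in blast)
    show "\<forall>\<^sub>F n in sequentially. ln (S n) / real n \<le> ln C / real n + P"
      by (rule eventually_mono[OF eventually_ge_at_top[of "1::nat"]]) (use bounds in blast)
    show "(\<lambda>n. - ln C / real n + P) \<longlonglongrightarrow> P"
      using tendsto_add[OF lim_const_over_n[of "- ln C"] tendsto_const[of P]] by simp
    show "(\<lambda>n. ln C / real n + P) \<longlonglongrightarrow> P"
      using tendsto_add[OF lim_const_over_n[of "ln C"] tendsto_const[of P]] by simp
  qed
qed

lemma sum_measure_cylinders:
  assumes M: "borel_prob_on (full_shift d) M"
  shows "(\<Sum>w\<in>words d n. measure M (cylinder (full_shift d) w)) = 1"
proof -
  note Mp = borel_prob_onD[OF M]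
  interpret prob_space M by (rule Mp)
  have "disjoint_family_on (cylinder (full_shift d)) (words d n)"
    unfolding disjoint_family_on_def by (auto simp: cylinder_def words_def)
  then have "measure M (\<Union>w\<in>words d n. cylinder (full_shift d) w)
      = (\<Sum>w\<in>words d n. measure M (cylinder (full_shift d) w))"
    using Mp(4) finite_words by (intro finite_measure_finite_Union) auto
  moreover have "(\<Union>w\<in>words d n. cylinder (full_shift d) w) = space M"
  proof -
    have "x \<in> cylinder (full_shift d) (prefix_word x n)" if "x \<in> full_shift d" for x
      using that by (simp add: cylinder_def)
    then show ?thesis
      unfolding Mp(3) using prefix_word_in_words by (force simp: cylinder_def)
  qed
  ultimately show ?thesis using prob_space by simp
qed

text \<open>
  The Kaenmaki bounds of two such measures refer to the same function of the word, so the measures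
  dominate each other on cylinders.
\<close>

lemma kaenmaki_measure_unique:
  assumes M: "kaenmaki_measure d l a b s M" and erg: "almost_ergodic shift M"
    and N: "kaenmaki_measure d l a b s N"
  shows "N = M"
proof -
  let ?X = "full_shift d"
  let ?P = "P_mat d l a b s"
  have Mb: "borel_prob_on ?X M" "shift_invariant M" and Nb: "borel_prob_on ?X N" "shift_invariant N"
    using M N by (auto simp: kaenmaki_measure_def)
  obtain C where C: "1 \<le> C" and low: "\<And>n w. 1 \<le> n \<Longrightarrow> w \<in> words d n \<Longrightarrow>
      inverse C * exp (- ?P * real n) * phi l a b s w \<le> measure M (cylinder ?X w)"
    using M unfolding kaenmaki_measure_def by blast
  obtain D where D: "1 \<le> D" and up: "\<And>n w. 1 \<le> n \<Longrightarrow> w \<in> words d n \<Longrightarrow>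
      measure N (cylinder ?X w) \<le> D * exp (- ?P * real n) * phi l a b s w"
    using N unfolding kaenmaki_measure_def by blast
  have "measure N (cylinder ?X w) \<le> (C * D) * measure M (cylinder ?X w)" for w
  proof (cases "cylinder ?X w = {}")
    case False
    then obtain x where x: "x \<in> ?X" "w = prefix_word x (length w)"
      using cylinder_nonempty_prefix by blast
    have w: "w \<in> words d (length w)"
      using prefix_word_in_words[OF x(1), of "length w"] unfolding x(2)[symmetric] .
    show ?thesis
    proof (cases "w = []")
      case True
      then have "cylinder ?X w = ?X" by (simp add: cylinder_def prefix_word_def)
      then have "measure N (cylinder ?X w) = 1" "measure M (cylinder ?X w) = 1"
        using prob_space.prob_space[OF borel_prob_onD(1)[OF Nb(1)]]
          prob_space.prob_space[OF borel_prob_onD(1)[OF Mb(1)]]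
          borel_prob_onD(3)[OF Nb(1)] borel_prob_onD(3)[OF Mb(1)] by auto
      then show ?thesis using mult_mono[OF C D] C by simp
    next
      case False
      then have n: "1 \<le> length w" by (simp add: Suc_le_eq)
      have "measure N (cylinder ?X w) \<le> D * exp (- ?P * real (length w)) * phi l a b s w"
        by (rule up[OF n w])
      also have "\<dots> = (C * D) * (inverse C * exp (- ?P * real (length w)) * phi l a b s w)"
        using C by simp
      also have "\<dots> \<le> (C * D) * measure M (cylinder ?X w)"
        using low[OF n w] C D by (intro mult_left_mono) auto
      finally show ?thesis .
    qed
  qed simp
  then show ?thesis
    using C D Mb Nb erg shift_full_shift
    by (intro almost_ergodic_dominated_eq[of ?X d M N "C * D"]) auto
qed

context two_copies
begin

lemma copy_forget_distr:
  assumes M: "borel_prob_on (Sigma_A d l) M" "shift_invariant M" "almost_ergodic shift M"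
  defines "N \<equiv> distr M (restrict_space borel (full_shift d)) (copy_forget d)"
  shows "borel_prob_on (full_shift d) N" "shift_invariant N" "almost_ergodic shift N"
proof -
  note Mp = borel_prob_onD[OF M(1)]
  interpret prob_space M by (rule Mp)
  have shift: "shift \<in> measurable M M"
    using shift_measurable[OF shift_Sigma_A] Mp(2) by (simp cong: measurable_cong_sets)
  have forget: "copy_forget d \<in> measurable M (restrict_space borel (full_shift d))"
    using copy_forget_measurable measurable_cong_sets[OF Mp(2) refl] by auto
  have comm: "copy_forget d (shift x) = shift (copy_forget d x)" for x
    by (simp add: copy_forget_def shift_def)
  show "borel_prob_on (full_shift d) N"
    unfolding borel_prob_on_def N_def using prob_space_distr[OF forget] by simp
  show "shift_invariant N"
    unfolding N_def
    by (rule shift_invariant_distr[OF M(2) shift shift_measurable[OF shift_full_shift] forget comm])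
  show "almost_ergodic shift N"
    unfolding N_def by (rule almost_ergodic_distr[OF M(3) forget comm shift])
qed

text \<open>
  The two summands of \<open>\<nu>[w]\<close> are comparable to the two row weights, and the sum of the two weights
  lies between their maximum \<open>\<phi>\<^sup>s(w)\<close> and twice this maximum.
\<close>

lemma nu_gibbs_bounds:
  assumes a: "\<And>i. i \<in> {1..d} \<Longrightarrow> 0 < a i" and b: "\<And>i. i \<in> {1..d} \<Longrightarrow> 0 < b i"
    and s: "0 < s" "s < 2"
    and m1: "gibbs_measure (Sigma_A d l) (f1 d a b s) m1"
    and m2: "gibbs_measure (Sigma_A d l) (f2 d a b s) (distr m1 m1 (copy_swap d))"
  shows "\<exists>C\<ge>1. \<forall>x\<in>full_shift d. \<forall>n\<ge>1.
      inverse C * (phi l a b s (prefix_word x n) * exp (- real n * top_pressure (Sigma_A d l) (f1 d a b s)))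
        \<le> measure (nu d l m1 (distr m1 m1 (copy_swap d))) (cylinder (full_shift d) (prefix_word x n)) \<and>
      measure (nu d l m1 (distr m1 m1 (copy_swap d))) (cylinder (full_shift d) (prefix_word x n))
        \<le> C * (phi l a b s (prefix_word x n) * exp (- real n * top_pressure (Sigma_A d l) (f1 d a b s)))"
proof -
  let ?X = "Sigma_A d l"
  let ?P = "top_pressure ?X (f1 d a b s)"
  let ?m2 = "distr m1 m1 (copy_swap d)"
  have P: "top_pressure ?X (f2 d a b s) = ?P"
    using f1_copy_swap by (rule top_pressure_copy_swap)
  obtain C where C: "1 \<le> C"
    and low1: "\<And>x n. x \<in> ?X \<Longrightarrow> inverse C * exp (birkhoff_sum (f1 d a b s) n x - real n * ?P)
         \<le> measure m1 (cylinder ?X (prefix_word x n))"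
    and up1: "\<And>x n. x \<in> ?X \<Longrightarrow> measure m1 (cylinder ?X (prefix_word x n))
         \<le> C * exp (birkhoff_sum (f1 d a b s) n x - real n * ?P)"
    using gibbs_measureD[OF m1] by metis
  obtain D where D: "1 \<le> D"
    and low2: "\<And>x n. x \<in> ?X \<Longrightarrow> inverse D * exp (birkhoff_sum (f2 d a b s) n x - real n * ?P)
         \<le> measure ?m2 (cylinder ?X (prefix_word x n))"
    and up2: "\<And>x n. x \<in> ?X \<Longrightarrow> measure ?m2 (cylinder ?X (prefix_word x n))
         \<le> D * exp (birkhoff_sum (f2 d a b s) n x - real n * ?P)"
    using gibbs_measureD[OF m2, unfolded P] by metis
  have m1b: "borel_prob_on ?X m1" and m2b: "borel_prob_on ?X ?m2"
    using m1 m2 by (auto simp: gibbs_measure_def)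
  interpret m1: prob_space m1 by (rule borel_prob_onD[OF m1b])
  interpret m2: prob_space ?m2 by (rule borel_prob_onD[OF m2b])
  show ?thesis
  proof (intro exI[of _ "C + D"] conjI ballI allI impI)
    show "1 \<le> C + D" using C D by simp
    fix x n assume x: "x \<in> full_shift d" and n: "1 \<le> (n::nat)"
    let ?cyl = "cylinder ?X (prefix_word (tau d l x) n)"
    define E where "E = exp (- real n * ?P)"
    define p where "p = row_entry l a b (prefix_word x n)"
    define q where "q = row_entry l b a (prefix_word x n)"
    have pos: "0 < p" "0 < q"
      using row_entry_pos[OF a b, where w = "prefix_word x n" and l = l] prefix_word_in_words[OF x, of n]
      by (auto simp: p_def q_def words_def)
    have E: "exp (birkhoff_sum f n (tau d l x) - real n * ?P) = exp (birkhoff_sum f n (tau d l x)) * E" for f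
      by (simp add: E_def exp_diff exp_minus field_simps)
    have w1: "exp (birkhoff_sum (f1 d a b s) n (tau d l x)) = row_weight s p q"
      unfolding p_def q_def by (rule exp_birkhoff_sum_tau[OF a b x])
    have w2: "exp (birkhoff_sum (f2 d a b s) n (tau d l x)) = row_weight s q p"
      unfolding p_def q_def f2_eq_f1 by (rule exp_birkhoff_sum_tau[OF b a x])
    have phi: "phi l a b s (prefix_word x n) = max (row_weight s p q) (row_weight s q p)"
      unfolding p_def q_def by (rule phi_eq_max_row_weight[OF s]) (use pos in \<open>auto simp: p_def q_def\<close>)
    have wpos: "0 < row_weight s p q * E" "0 < row_weight s q p * E"
      using pos by (auto simp: row_weight_def E_def)
    have t: "tau d l x \<in> ?X" using x by (rule tau_Sigma_A)
    have nu: "measure (nu d l m1 ?m2) (cylinder (full_shift d) (prefix_word x n))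
        = measure m1 ?cyl + measure ?m2 ?cyl"
    proof -
      have "emeasure (nu d l m1 ?m2) (cylinder (full_shift d) (prefix_word x n))
          = emeasure m1 ?cyl + emeasure ?m2 ?cyl"
        unfolding nu_eq_distr[OF m1b] emeasure_copy_forget[OF m1b cylinder_measurable]
          tau_image_cylinder[OF x n] ..
      then have "measure (nu d l m1 ?m2) (cylinder (full_shift d) (prefix_word x n))
          = enn2real (emeasure m1 ?cyl + emeasure ?m2 ?cyl)"
        by (simp only: measure_def)
      also have "\<dots> = measure m1 ?cyl + measure ?m2 ?cyl"
        unfolding measure_def by (rule enn2real_plus) (simp_all add: less_top[symmetric])
      finally show ?thesis .
    qed
    have bounds: "inverse C * (row_weight s p q * E) \<le> measure m1 ?cyl"
        "measure m1 ?cyl \<le> C * (row_weight s p q * E)"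
        "inverse D * (row_weight s q p * E) \<le> measure ?m2 ?cyl"
        "measure ?m2 ?cyl \<le> D * (row_weight s q p * E)"
      using low1[OF t, of n] up1[OF t, of n] low2[OF t, of n] up2[OF t, of n]
      unfolding E w1 w2 by blast+
    have phiE: "phi l a b s (prefix_word x n) * E = max (row_weight s p q * E) (row_weight s q p * E)"
      unfolding phi by (simp add: max_mult_distrib_right E_def)
    have inv: "inverse (C + D) \<le> inverse C" "inverse (C + D) \<le> inverse D"
      using C D by (auto intro: le_imp_inverse_le)
    show "inverse (C + D) * (phi l a b s (prefix_word x n) * exp (- real n * ?P))
        \<le> measure (nu d l m1 ?m2) (cylinder (full_shift d) (prefix_word x n))"
      unfolding nu E_def[symmetric] phiE
    proof (cases "row_weight s p q * E \<le> row_weight s q p * E")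
      case True
      have "inverse (C + D) * (row_weight s q p * E) \<le> inverse D * (row_weight s q p * E)"
        using inv wpos by (intro mult_right_mono) auto
      then show "inverse (C + D) * max (row_weight s p q * E) (row_weight s q p * E)
          \<le> measure m1 ?cyl + measure ?m2 ?cyl"
        using bounds(3) True measure_nonneg[of m1 ?cyl] unfolding max_absorb2[OF True] by linarith
    next
      case False
      then have max: "max (row_weight s p q * E) (row_weight s q p * E) = row_weight s p q * E" by simp
      have "inverse (C + D) * (row_weight s p q * E) \<le> inverse C * (row_weight s p q * E)"
        using inv wpos by (intro mult_right_mono) auto
      then show "inverse (C + D) * max (row_weight s p q * E) (row_weight s q p * E)
          \<le> measure m1 ?cyl + measure ?m2 ?cyl"
        using bounds(1) measure_nonneg[of ?m2 ?cyl] unfolding max by linarith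
    qed
    have "C * (row_weight s p q * E) \<le> C * max (row_weight s p q * E) (row_weight s q p * E)"
      "D * (row_weight s q p * E) \<le> D * max (row_weight s p q * E) (row_weight s q p * E)"
      using C D by (auto intro!: mult_left_mono)
    then show "measure (nu d l m1 ?m2) (cylinder (full_shift d) (prefix_word x n))
        \<le> (C + D) * (phi l a b s (prefix_word x n) * exp (- real n * ?P))"
      unfolding nu E_def[symmetric] phiE distrib_right using bounds(2,4) by linarith
  qed
qed

end

theorem corollary1p5:
  fixes d l :: nat and a b :: "nat \<Rightarrow> real" and s :: real
    and m1 m2 :: "(nat \<Rightarrow> nat) measure"
  assumes l: "1 < l" "l \<le> d"
    and a: "\<And>i. i \<in> {1..d} \<Longrightarrow> 0 < a i \<and> a i < 1"
    and b: "\<And>i. i \<in> {1..d} \<Longrightarrow> 0 < b i \<and> b i < 1"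
    and neq: "\<exists>i\<in>{1..l-1}. a i \<noteq> b i"
    and s: "0 < s" "s < 2"
    and m1: "gibbs_measure (Sigma_A d l) (f1 d a b s) m1"
    and m2: "gibbs_measure (Sigma_A d l) (f2 d a b s) m2"
  shows "(\<exists>C>0. \<forall>x\<in>full_shift d. \<forall>n\<ge>1.
            inverse C \<le> measure (nu d l m1 m2) (cylinder (full_shift d) (prefix_word x n))
                / (phi l a b s (prefix_word x n)
                   * exp (- real n * top_pressure (Sigma_A d l) (f1 d a b s))) \<and>
            measure (nu d l m1 m2) (cylinder (full_shift d) (prefix_word x n))
                / (phi l a b s (prefix_word x n)
                   * exp (- real n * top_pressure (Sigma_A d l) (f1 d a b s))) \<le> C)
       \<and> kaenmaki_measure d l a b s (nu d l m1 m2)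
       \<and> (\<forall>m. kaenmaki_measure d l a b s m \<longrightarrow> nu d l m1 m2 = m)
       \<and> P_mat d l a b s = top_pressure (Sigma_A d l) (f1 d a b s)
       \<and> P_mat d l a b s = top_pressure (Sigma_A d l) (f2 d a b s)"
proof -
  interpret two_copies d l by unfold_locales (rule l)+
  let ?X = "full_shift d"
  let ?nu = "nu d l m1 m2"
  let ?P = "top_pressure (Sigma_A d l) (f1 d a b s)"
  have d: "1 \<le> d" using l by simp
  have apos: "\<And>i. i \<in> {1..d} \<Longrightarrow> 0 < a i" and bpos: "\<And>i. i \<in> {1..d} \<Longrightarrow> 0 < b i"
    using a b by auto
  have m1': "borel_prob_on (Sigma_A d l) m1" "shift_invariant m1"
    using m1 by (auto simp: gibbs_measure_def)
  have P2: "top_pressure (Sigma_A d l) (f2 d a b s) = ?P"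
    using f1_copy_swap by (rule top_pressure_copy_swap)
  have swap: "gibbs_measure (Sigma_A d l) (f2 d a b s) (distr m1 m1 (copy_swap d))"
    using m1 f1_copy_swap by (rule gibbs_measure_copy_swap)
  have "f2 d a b s x = f2 d a b s (\<lambda>_. x 0)" for x by (simp add: f2_def)
  then have m2_eq: "m2 = distr m1 m1 (copy_swap d)"
    by (rule gibbs_unique[OF swap m2])
  have "f1 d a b s x = f1 d a b s (\<lambda>_. x 0)" for x by (simp add: f1_def)
  then have erg1: "almost_ergodic shift m1"
    by (rule gibbs_almost_ergodic[OF m1])
  have nu: "borel_prob_on ?X ?nu" "shift_invariant ?nu" "almost_ergodic shift ?nu"
    using copy_forget_distr[OF m1' erg1] unfolding m2_eq nu_eq_distr[OF m1'(1)] by auto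
  have phi_pos: "0 < phi l a b s w" if "w \<in> words d n" for w n
  proof -
    have "0 < row_entry l a b w" "0 < row_entry l b a w"
      using row_entry_pos[OF apos bpos, where w = w and l = l] that by (auto simp: words_def)
    then show ?thesis
      using phi_eq_max_row_weight[OF s, of l a b w] by (simp add: row_weight_def less_max_iff_disj)
  qed
  obtain C where C: "1 \<le> C"
    and low: "\<And>x n. x \<in> ?X \<Longrightarrow> 1 \<le> n \<Longrightarrow>
      inverse C * (phi l a b s (prefix_word x n) * exp (- real n * ?P))
        \<le> measure ?nu (cylinder ?X (prefix_word x n))"
    and up: "\<And>x n. x \<in> ?X \<Longrightarrow> 1 \<le> n \<Longrightarrow> measure ?nu (cylinder ?X (prefix_word x n))
        \<le> C * (phi l a b s (prefix_word x n) * exp (- real n * ?P))"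
    using nu_gibbs_bounds[OF apos bpos s m1 swap] unfolding m2_eq by blast
  have low': "inverse C * (phi l a b s w * exp (- real n * ?P)) \<le> measure ?nu (cylinder ?X w)"
    and up': "measure ?nu (cylinder ?X w) \<le> C * (phi l a b s w * exp (- real n * ?P))"
    if w: "w \<in> words d n" and n: "1 \<le> n" for w n
  proof -
    obtain x where "x \<in> ?X" "w = prefix_word x n" using words_eq_prefix_word[OF w d] .
    then show "inverse C * (phi l a b s w * exp (- real n * ?P)) \<le> measure ?nu (cylinder ?X w)"
      and "measure ?nu (cylinder ?X w) \<le> C * (phi l a b s w * exp (- real n * ?P))"
      using low up n by auto
  qed
  \<comment> \<open>The masses \<open>\<nu>[w]\<close> over all words of length \<open>n\<close> add up to 1, so the sum of \<open>\<phi>\<^sup>s\<close> is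
      comparable to \<open>exp (n P)\<close>.\<close>
  have P: "P_mat d l a b s = ?P"
    unfolding P_mat_def
  proof (rule lim_ln_over_n[OF C])
    fix n :: nat assume n: "1 \<le> n"
    let ?S = "\<Sum>w\<in>words d n. phi l a b s w"
    have "inverse C * (?S * exp (- real n * ?P))
        = (\<Sum>w\<in>words d n. inverse C * (phi l a b s w * exp (- real n * ?P)))"
      by (simp add: sum_distrib_left sum_distrib_right)
    also have "\<dots> \<le> (\<Sum>w\<in>words d n. measure ?nu (cylinder ?X w))"
      by (intro sum_mono low' n)
    finally have "inverse C * (?S * exp (- real n * ?P)) \<le> 1"
      unfolding sum_measure_cylinders[OF nu(1)] .
    then show "?S \<le> C * exp (real n * ?P)"
      using C by (simp add: exp_minus field_simps)
    have "(\<Sum>w\<in>words d n. measure ?nu (cylinder ?X w))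
        \<le> (\<Sum>w\<in>words d n. C * (phi l a b s w * exp (- real n * ?P)))"
      by (intro sum_mono up' n)
    also have "\<dots> = C * (?S * exp (- real n * ?P))"
      by (simp add: sum_distrib_left sum_distrib_right)
    finally have "1 \<le> C * (?S * exp (- real n * ?P))"
      unfolding sum_measure_cylinders[OF nu(1)] .
    then show "inverse C * exp (real n * ?P) \<le> ?S"
      using C by (simp add: exp_minus field_simps)
  qed
  have ratio: "\<exists>C>0. \<forall>x\<in>?X. \<forall>n\<ge>1.
      inverse C \<le> measure ?nu (cylinder ?X (prefix_word x n))
        / (phi l a b s (prefix_word x n) * exp (- real n * ?P)) \<and>
      measure ?nu (cylinder ?X (prefix_word x n))
        / (phi l a b s (prefix_word x n) * exp (- real n * ?P)) \<le> C"
  proof (intro exI[of _ C] conjI ballI allI impI)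
    show "0 < C" using C by simp
    fix x n assume x: "x \<in> ?X" and n: "1 \<le> (n::nat)"
    have pos: "0 < phi l a b s (prefix_word x n) * exp (- real n * ?P)"
      using phi_pos[OF prefix_word_in_words[OF x]] by simp
    show "inverse C \<le> measure ?nu (cylinder ?X (prefix_word x n))
        / (phi l a b s (prefix_word x n) * exp (- real n * ?P))"
      unfolding pos_le_divide_eq[OF pos] by (rule low[OF x n])
    show "measure ?nu (cylinder ?X (prefix_word x n))
        / (phi l a b s (prefix_word x n) * exp (- real n * ?P)) \<le> C"
      unfolding pos_divide_le_eq[OF pos] by (rule up[OF x n])
  qed
  have kaenmaki: "kaenmaki_measure d l a b s ?nu"
    unfolding kaenmaki_measure_def P
  proof (intro conjI nu shift_ergodic_if_almost_ergodic exI[of _ C] C allI impI ballI)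
    fix n w assume n: "1 \<le> (n::nat)" and w: "w \<in> words d n"
    show "inverse C * exp (- ?P * real n) * phi l a b s w \<le> measure ?nu (cylinder ?X w)"
      using low'[OF w n] by (simp add: mult_ac)
    show "measure ?nu (cylinder ?X w) \<le> C * exp (- ?P * real n) * phi l a b s w"
      using up'[OF w n] by (simp add: mult_ac)
  qed
  have unique: "\<forall>m. kaenmaki_measure d l a b s m \<longrightarrow> ?nu = m"
    by (intro allI impI kaenmaki_measure_unique[OF kaenmaki nu(3), symmetric])
  have P': "P_mat d l a b s = top_pressure (Sigma_A d l) (f2 d a b s)"
    unfolding P2 by (rule P)
  show ?thesis
    by (rule conjI[OF ratio conjI[OF kaenmaki conjI[OF unique conjI[OF P P']]]])
qed

end
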